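(* Let $0<q<1$, let $\mu\in\mathcal{V}_q$, and let $t_1,t_2\in\mathbf{C}$ be such that $t_1t_2\neq -q^{n+1}$ for all integers $n\ge 1$ and $t_1t_2\ne -q^{1-k}$ for all integers $k\ge 0$. Then the Al-Salam-Chihara polynomials $\{u_n(x;t_1,t_2)\}_{n\ge0}$ are orthogonal with respect to the complex measure $\nu_\mu(t_1,t_2)$ on $\mathbf{R}$ given by $$d\nu_\mu(x;t_1,t_2)=\frac{\chi_{t_1}(x)\chi_{t_2}(x)}{(-t_1t_2/q;q)_\infty}\,d\mu(x).$$
   Context: Notation: $(a;q)_0=1$, $(a;q)_n=\prod_{k=1}^n(1-aq^{k-1})$ for $n=1,2,\ldots$ or $n=\infty$, and $(a_1,\ldots,a_k;q)_n=\prod_{j=1}^k(a_j;q)_n$. The $q^{-1}$-Hermite polynomials $h_n(x|q)$ are defined by $h_0(x|q)=1$, $h_1(x|q)=2x$ and $h_{n+1}(x|q)=2x\,h_n(x|q)-q^{-n}(1-q^n)h_{n-1}(x|q)$ for $n>0$. $\mathcal{V}_q$ denotes the set of probability measures $\mu$ on $\mathbf{R}$ with moments of every order that are orthogonality measures for these polynomials, i.e. $$\int_{-\infty}^\infty h_m(x|q)h_n(x|q)\,d\mu(x)=q^{-n(n+1)/2}(q;q)_n\delta_{m,n}\qquad (m,n\ge 0).$$ For $t\in\mathbf{C}$ and $x\in\mathbf{R}$, $$\chi_t(x)=\bigl(-t(\sqrt{x^2+1}+x),\,t(\sqrt{x^2+1}-x);q\bigr)_\infty ,$$ equivalently $\chi_t(\sinh\xi)=(-te^{\xi},te^{-\xi};q)_\infty$.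 For every $\mu\in\mathcal{V}_q$ and $t\in\mathbf{C}$ one has $\chi_t\in L^2(\mu)$, and every polynomial is integrable with respect to $\nu_\mu(t_1,t_2)$. The polynomials $u_n(x)=u_n(x;t_1,t_2)$ (the special case $u_n(x;t_1,t_2)=v_n(-2x;q,-(t_1+t_2)/q,t_1t_2q^{-2},-1)$ of the polynomials $v_n(x;q,a,b,c)$ satisfying $(1-q^{n+1})v_{n+1}=(a-xq^n)v_n-(b-cq^{n-1})v_{n-1}$) are defined by $u_{-1}=0$, $u_0=1$ and $$(1-q^{n+1})u_{n+1}(x)=\Bigl(2xq^n-\frac{t_1+t_2}{q}\Bigr)u_n(x)-\bigl(t_1t_2q^{-2}+q^{n-1}\bigr)u_{n-1}(x),\qquad n\ge 0.$$ Polynomials $\{u_n\}$ with $\deg u_n=n$ are said to be orthogonal with respect to a complex measure $\nu$ if $\int u_mu_n\,d\nu=0$ for $m\ne n$ and $\int u_n^2\,d\nu\neq 0$ for all $n\ge 0$ (no complex conjugation). *)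

theory Defs
  imports "HOL-Analysis.Analysis" "HOL-Probability.Probability_Measure"
    "HOL-Computational_Algebra.Polynomial"
begin

definition qpoch :: "'a::comm_ring_1 \<Rightarrow> 'a \<Rightarrow> nat \<Rightarrow> 'a" where
  "qpoch a q n = (\<Prod>k=1..n. 1 - a * q ^ (k - 1))"

definition qpoch_inf :: "'a::real_normed_field \<Rightarrow> 'a \<Rightarrow> 'a" where
  "qpoch_inf a q = (\<Prod>k. 1 - a * q ^ k)"

fun qinv_hermite :: "real \<Rightarrow> nat \<Rightarrow> real poly" where
  "qinv_hermite q 0 = 1"
| "qinv_hermite q (Suc 0) = [:0, 2:]"
| "qinv_hermite q (Suc (Suc n)) =
     [:0, 2:] * qinv_hermite q (Suc n)
       - smult ((1 - q ^ Suc n) / q ^ Suc n) (qinv_hermite q n)"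

text \<open>The class \<open>\<V>\<^sub>q\<close>. Since \<open>n * (n + 1)\<close> is even, the natural-number division by 2 is exact.\<close>

definition qinv_hermite_measures :: "real \<Rightarrow> real measure set" where
  "qinv_hermite_measures q =
     {\<mu>. prob_space \<mu> \<and> sets \<mu> = sets borel \<and> (\<forall>n. integrable \<mu> (\<lambda>x. x ^ n)) \<and>
        (\<forall>m n. (\<integral>x. poly (qinv_hermite q m) x * poly (qinv_hermite q n) x \<partial>\<mu>) =
           (if m = n then qpoch q q n / q ^ (n * (n + 1) div 2) else 0))}"

definition chi :: "real \<Rightarrow> complex \<Rightarrow> real \<Rightarrow> complex" where
  "chi q t x =
     qpoch_inf (- t * of_real (sqrt (x\<^sup>2 + 1) + x)) (of_real q) *
     qpoch_inf (t * of_real (sqrt (x\<^sup>2 + 1) - x)) (of_real q)"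

text \<open>The second equation is the case \<open>n = 0\<close> of the three-term recurrence, with \<open>u\<^bsub>-1\<^esub> = 0\<close>.\<close>

fun alsalam_chihara :: "real \<Rightarrow> complex \<Rightarrow> complex \<Rightarrow> nat \<Rightarrow> complex poly" where
  "alsalam_chihara q t1 t2 0 = 1"
| "alsalam_chihara q t1 t2 (Suc 0) =
     smult (1 / (1 - of_real q)) [:- (t1 + t2) / of_real q, 2:]"
| "alsalam_chihara q t1 t2 (Suc (Suc n)) =
     smult (1 / (1 - of_real q ^ (n + 2)))
       ([:- (t1 + t2) / of_real q, 2 * of_real q ^ (n + 1):] * alsalam_chihara q t1 t2 (Suc n)
        - smult (t1 * t2 / (of_real q)\<^sup>2 + of_real q ^ n) (alsalam_chihara q t1 t2 n))"

text \<open>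
  A complex measure is a countably additive complex-valued function on the sigma-algebra of \<open>M\<close>
  (only \<open>sets M\<close> is used). Integration is defined through the Jordan decompositions of the real
  and imaginary parts.
\<close>

definition complex_measure :: "'a measure \<Rightarrow> ('a set \<Rightarrow> complex) \<Rightarrow> bool" where
  "complex_measure M \<nu> \<longleftrightarrow>
     \<nu> {} = 0 \<and>
     (\<forall>A :: nat \<Rightarrow> 'a set. range A \<subseteq> sets M \<longrightarrow> disjoint_family A \<longrightarrow>
        (\<lambda>i. \<nu> (A i)) sums \<nu> (\<Union>i. A i))"

text \<open>
  The positive variation \<open>\<phi>\<^sup>+(A) = sup {\<phi>(B) | B \<subseteq> A}\<close> of a real signed measure. The function
  \<^const>\<open>ennreal\<close> maps negative values to 0, which is harmless because \<open>B = {}\<close> is admitted. The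
  negative variation of \<open>\<phi>\<close> is the positive variation of \<open>-\<phi>\<close>.
\<close>

definition pos_variation :: "'a measure \<Rightarrow> ('a set \<Rightarrow> real) \<Rightarrow> 'a measure" where
  "pos_variation M \<phi> =
     measure_of (space M) (sets M) (\<lambda>A. SUP B\<in>{B \<in> sets M. B \<subseteq> A}. ennreal (\<phi> B))"

definition cm_integrable ::
  "'a measure \<Rightarrow> ('a set \<Rightarrow> complex) \<Rightarrow> ('a \<Rightarrow> complex) \<Rightarrow> bool" where
  "cm_integrable M \<nu> f \<longleftrightarrow>
     integrable (pos_variation M (\<lambda>A. Re (\<nu> A))) f \<and>
     integrable (pos_variation M (\<lambda>A. - Re (\<nu> A))) f \<and>
     integrable (pos_variation M (\<lambda>A. Im (\<nu> A))) f \<and>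
     integrable (pos_variation M (\<lambda>A. - Im (\<nu> A))) f"

definition cm_integral ::
  "'a measure \<Rightarrow> ('a set \<Rightarrow> complex) \<Rightarrow> ('a \<Rightarrow> complex) \<Rightarrow> complex" where
  "cm_integral M \<nu> f =
     (integral\<^sup>L (pos_variation M (\<lambda>A. Re (\<nu> A))) f
        - integral\<^sup>L (pos_variation M (\<lambda>A. - Re (\<nu> A))) f)
     + \<i> * (integral\<^sup>L (pos_variation M (\<lambda>A. Im (\<nu> A))) f
        - integral\<^sup>L (pos_variation M (\<lambda>A. - Im (\<nu> A))) f)"

text \<open>
  Orthogonality in the bilinear sense, without complex conjugation. Integrability is required
  explicitly because the Bochner integral of a non-integrable function is 0.
\<close>

definition orthogonal_polys :: "(real set \<Rightarrow> complex) \<Rightarrow> (nat \<Rightarrow> complex poly) \<Rightarrow> bool" where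
  "orthogonal_polys \<nu> p \<longleftrightarrow>
     (\<forall>n. degree (p n) = n) \<and>
     (\<forall>m n. cm_integrable borel \<nu> (\<lambda>x. poly (p m) (of_real x) * poly (p n) (of_real x))) \<and>
     (\<forall>m n. m \<noteq> n \<longrightarrow>
        cm_integral borel \<nu> (\<lambda>x. poly (p m) (of_real x) * poly (p n) (of_real x)) = 0) \<and>
     (\<forall>n. cm_integral borel \<nu> (\<lambda>x. (poly (p n) (of_real x))\<^sup>2) \<noteq> 0)"

definition nu_measure :: "real \<Rightarrow> real measure \<Rightarrow> complex \<Rightarrow> complex \<Rightarrow> real set \<Rightarrow> complex" where
  "nu_measure q \<mu> t1 t2 A =
     (LINT x:A|\<mu>. chi q t1 x * chi q t2 x / qpoch_inf (- (t1 * t2) / of_real q) (of_real q))"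

end

(*
  The functional L p = \<integral> p \<chi>_s \<chi>_t d\<mu> is determined by two facts. Expanding \<chi>_t in the q^{-1}-Hermite
  polynomials and integrating term by term gives L 1 = (-st/q; q)_\<infinity>. Moreover
  \<chi>_{s/q} = (1 + 2xs/q - s^2/q^2) \<chi>_s, so a contiguous relation between u_n(x; s/q, t) and
  u_{n+1}(x; s, t), u_n(x; s, t) turns into a recursion in n for L u_n, valid for all s \<noteq> 0 at once,
  which yields L u_n = 0 for n \<ge> 1; the case s = 0 \<noteq> t follows by symmetry. As in Favard's theorem, the
  three-term recurrence then gives the orthogonality.
*)
theory Submission
  imports Defs
begin

text \<open>Two obstacles shape the argument. Expanding under the integral sign requires a
  \<mu>-integrable majorant; it exists because the coefficients of the expansion decay like
  q^(n(n-1)/2), which beats the growth q^(-n) of the rescaled norms. And a polynomial times \<chi>_s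
  \<chi>_t must be known to be integrable: this is carried along with the value of the integral in
  the same induction on n, and then passed from u_n to x^k u_n by the three-term recurrence.

  At a fixed s the contiguous relation gives no closed recursion, since it ties the functional at
  s/q to the one at s; only a statement about all s can be proved by induction.\<close>

section \<open>Power series whose coefficients obey a q-recurrence\<close>

text \<open>Since 1 - q^(n+2) \<ge> 1 - q, each term is at most K q^n times the sum of its two
  predecessors. As K q^n tends to 0, the sequence decays faster than any geometric one, so its power
  series is entire.\<close>

lemma recurrence_decay:
  fixes c :: "nat \<Rightarrow> complex" and a b :: complex and q r :: real
  assumes q: "0 < q" "q < 1" and r: "0 < r"
    and rec: "\<And>n. (1 - of_real q ^ (n + 2)) * c (n + 2)
      = a * of_real q ^ (n + 1) * c (n + 1) + b * of_real q ^ n * c n"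
  obtains C where "\<And>n. norm (c n) \<le> C * r ^ n"
proof -
  define K where "K = (norm a + norm b) / (1 - q)"
  have K: "K \<ge> 0" using q by (simp add: K_def)
  have step: "norm (c (n + 2)) \<le> K * q ^ n * (norm (c (n + 1)) + norm (c n))" for n
  proof -
    have "q ^ (n + 2) \<le> q" using q power_decreasing[of 1 "n + 2" q] by simp
    then have "(1 - q) * norm (c (n + 2)) \<le> (1 - q ^ (n + 2)) * norm (c (n + 2))"
      by (intro mult_right_mono) auto
    also have "\<dots> = norm ((1 - of_real q ^ (n + 2)) * c (n + 2))"
    proof -
      have "norm (1 - of_real q ^ (n + 2) :: complex) = \<bar>1 - q ^ (n + 2)\<bar>"
        using norm_of_real[of "1 - q ^ (n + 2)", where 'a = complex] by simp
      then show ?thesis using \<open>q ^ (n + 2) \<le> q\<close> q by (simp only: norm_mult)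
    qed
    also have "\<dots> \<le> norm a * q ^ (n + 1) * norm (c (n + 1)) + norm b * q ^ n * norm (c n)"
      unfolding rec using q by (intro order.trans[OF norm_triangle_ineq]) (simp add: norm_mult norm_power)
    also have "\<dots> \<le> norm a * q ^ n * norm (c (n + 1)) + norm b * q ^ n * norm (c n)"
      using q by (intro add_mono mult_right_mono mult_left_mono power_decreasing) auto
    also have "\<dots> \<le> (norm a + norm b) * q ^ n * (norm (c (n + 1)) + norm (c n))"
      using q by (simp add: algebra_simps)
    finally show ?thesis using q by (simp add: K_def field_simps)
  qed
  \<comment> \<open>Chosen as the solution of \<delta> (r^(m+1) + r^m) = r^(m+2), which closes the
    induction step.\<close>
  define \<delta> where "\<delta> = r\<^sup>2 / (r + 1)"
  have "(\<lambda>n. K * q ^ n) \<longlonglongrightarrow> K * 0"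
    using q by (intro tendsto_intros LIMSEQ_realpow_zero) auto
  moreover have "0 < \<delta>" using r by (simp add: \<delta>_def)
  ultimately have "\<forall>\<^sub>F n in sequentially. K * q ^ n < \<delta>"
    by (intro order_tendstoD(2)) auto
  then obtain N where N: "\<And>n. n \<ge> N \<Longrightarrow> K * q ^ n < \<delta>"
    by (auto simp: eventually_sequentially)
  \<comment> \<open>The sum must reach N + 1: the step looks back two indices, so n = N + 2 is the
    first one it can handle.\<close>
  define C where "C = (\<Sum>n\<le>N + 1. norm (c n) / r ^ n)"
  have "norm (c n) \<le> C * r ^ n" for n
  proof (induction n rule: less_induct)
    case (less n)
    show ?case
    proof (cases "n \<le> N + 1")
      case True
      have "norm (c n) / r ^ n \<le> C"
        unfolding C_def using True r
        by (intro member_le_sum[where f = "\<lambda>n. norm (c n) / r ^ n"]) auto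
      then show ?thesis using r by (simp add: field_simps)
    next
      case False
      then have m: "n = (n - 2) + 2" "n - 2 \<ge> N" by auto
      define m where "m = n - 2"
      note m = m[folded m_def]
      have "norm (c n) \<le> K * q ^ m * (norm (c (m + 1)) + norm (c m))" using step m by simp
      also have "\<dots> \<le> \<delta> * (C * r ^ (m + 1) + C * r ^ m)"
        using less.IH[of m] less.IH[of "m + 1"] m N[of m] K q \<open>0 < \<delta>\<close>
        by (intro mult_mono add_mono) auto
      also have "\<dots> = C * r ^ m * (\<delta> * (r + 1))" by (simp add: algebra_simps)
      also have "\<delta> * (r + 1) = r\<^sup>2" using r by (simp add: \<delta>_def)
      finally show ?thesis using m by (simp add: power2_eq_square mult_ac)
    qed
  qed
  then show ?thesis using that by blast
qed

text \<open>Decay at a rate r \<le> 1 with r |t| \<le> 1/2 bounds both series by a geometric series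
  of ratio 1/2. The weighted squares serve the majorant obtained later from the Cauchy-Schwarz
  inequality.\<close>

lemma recurrence_summable:
  fixes c :: "nat \<Rightarrow> complex" and a b t :: complex and q :: real
  assumes q: "0 < q" "q < 1"
    and rec: "\<And>n. (1 - of_real q ^ (n + 2)) * c (n + 2)
      = a * of_real q ^ (n + 1) * c (n + 1) + b * of_real q ^ n * c n"
  shows "summable (\<lambda>n. c n * t ^ n)"
    and "summable (\<lambda>n. (norm (c n))\<^sup>2 * norm t ^ n)"
proof -
  have "\<exists>r>0. r \<le> 1 \<and> r * x \<le> 1 / 2" if "0 \<le> x" for x :: real
    using that by (intro exI[of _ "1 / (2 * (x + 1))"]) (simp add: field_simps)
  from this[OF norm_ge_zero[of t]] obtain r where r: "0 < r" "r \<le> 1" "r * norm t \<le> 1 / 2"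
    by blast
  obtain C where C: "\<And>n. norm (c n) \<le> C * r ^ n"
    using recurrence_decay[OF q r(1), of c a b] rec by metis
  have C0: "0 \<le> C" using C[of 0] norm_ge_zero[of "c 0"] by (simp del: norm_ge_zero)
  show "summable (\<lambda>n. c n * t ^ n)"
  proof (rule summable_comparison_test')
    show "summable (\<lambda>n. C * (1 / 2 :: real) ^ n)" by (intro summable_mult summable_geometric) auto
    show "norm (c n * t ^ n) \<le> C * (1 / 2) ^ n" for n
    proof -
      have "norm (c n * t ^ n) \<le> C * r ^ n * norm t ^ n"
        using C[of n] by (simp add: norm_mult norm_power mult_right_mono)
      also have "\<dots> = C * (r * norm t) ^ n" by (simp add: power_mult_distrib)
      also have "\<dots> \<le> C * (1 / 2) ^ n" using r C0 by (intro mult_left_mono power_mono) auto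
      finally show ?thesis .
    qed
  qed
  show "summable (\<lambda>n. (norm (c n))\<^sup>2 * norm t ^ n)"
  proof (rule summable_comparison_test')
    show "summable (\<lambda>n. C\<^sup>2 * (1 / 2 :: real) ^ n)" by (intro summable_mult summable_geometric) auto
    show "norm ((norm (c n))\<^sup>2 * norm t ^ n) \<le> C\<^sup>2 * (1 / 2) ^ n" for n
    proof -
      have "(norm (c n))\<^sup>2 * norm t ^ n \<le> (C * r ^ n)\<^sup>2 * norm t ^ n"
        using C[of n] by (intro mult_right_mono power_mono) auto
      also have "\<dots> = C\<^sup>2 * (r * (r * norm t)) ^ n"
        by (simp add: power_mult_distrib power2_eq_square)
      also have "\<dots> \<le> C\<^sup>2 * (1 / 2) ^ n"
        using r mult_mono[of r 1 "r * norm t" "1 / 2"]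
        by (intro mult_left_mono power_mono) auto
      finally show ?thesis by simp
    qed
  qed
qed

text \<open>Multiplied by t^(n+2), the recurrence has terms of the series at q t on its right side.
  Summation gives f(t) - f(q t) = (a t + b t^2) f(q t).\<close>

lemma recurrence_powser_functional_equation:
  fixes c :: "nat \<Rightarrow> complex" and a b t :: complex and q :: real
  assumes q: "0 < q" "q < 1"
    and rec1: "(1 - of_real q) * c 1 = a * c 0"
    and rec: "\<And>n. (1 - of_real q ^ (n + 2)) * c (n + 2)
      = a * of_real q ^ (n + 1) * c (n + 1) + b * of_real q ^ n * c n"
  shows "(\<Sum>n. c n * t ^ n) = (1 + a * t + b * t\<^sup>2) * (\<Sum>n. c n * (of_real q * t) ^ n)"
proof -
  define d where "d n = c n * (of_real q * t) ^ n" for n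
  have d: "d sums suminf d"
    unfolding d_def using recurrence_summable(1)[OF q rec] by (rule summable_sums)
  have d': "(\<lambda>n. d (n + 1)) sums (suminf d - d 0)"
    using d by (simp add: sums_Suc_iff)
  have "c (n + 2) * t ^ (n + 2) - d (n + 2) = a * t * d (n + 1) + b * t\<^sup>2 * d n" for n
  proof -
    have "c (n + 2) * t ^ (n + 2) - d (n + 2) = ((1 - of_real q ^ (n + 2)) * c (n + 2)) * t ^ (n + 2)"
      by (simp add: d_def power_mult_distrib algebra_simps)
    also have "\<dots> = a * t * d (n + 1) + b * t\<^sup>2 * d n"
      unfolding rec by (simp add: d_def power_mult_distrib algebra_simps power2_eq_square)
    finally show ?thesis .
  qed
  moreover have "(\<lambda>n. a * t * d (n + 1) + b * t\<^sup>2 * d n)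
      sums (a * t * (suminf d - d 0) + b * t\<^sup>2 * suminf d)"
    by (intro sums_add sums_mult d d')
  ultimately have "(\<lambda>n. c (n + 2) * t ^ (n + 2) - d (n + 2))
      sums (a * t * (suminf d - d 0) + b * t\<^sup>2 * suminf d)"
    by simp
  \<comment> \<open>\<open>rec1\<close> is the recurrence at n = -1 with c_{-1} = 0. It supplies the
    term that the shift by two leaves out.\<close>
  moreover have "(\<Sum>n<2. c n * t ^ n - d n) = a * t * d 0"
  proof -
    have "(\<Sum>n<2. c n * t ^ n - d n) = t * ((1 - of_real q) * c 1)"
      by (simp add: d_def numeral_2_eq_2 algebra_simps)
    then show ?thesis unfolding rec1 by (simp add: d_def)
  qed
  ultimately have 1: "(\<lambda>n. c n * t ^ n - d n) sums ((a * t + b * t\<^sup>2) * suminf d)"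
    using sums_iff_shift[of "\<lambda>n. c n * t ^ n - d n" 2] by (simp add: algebra_simps)
  have "(\<lambda>n. c n * t ^ n) sums ((a * t + b * t\<^sup>2) * suminf d + suminf d)"
    using sums_add[OF 1 d] by simp
  then show ?thesis
    unfolding d_def[abs_def] by (simp only: sums_unique[symmetric]) (simp only: ring_distribs mult_1_left ac_simps)
qed

text \<open>Iterating the functional equation gives f(t) = P N f(t q^N), and f(t q^N) tends to f(0)
  = 1. The pair (a, b) will be (1, 0) for Euler's product and (2 x, -1) for
  \<open>chi\<close>.\<close>

lemma recurrence_powser_product:
  fixes c :: "nat \<Rightarrow> complex" and a b t :: complex and q :: real
  assumes q: "0 < q" "q < 1"
    and "c 0 = 1" and rec1: "(1 - of_real q) * c 1 = a * c 0"
    and rec: "\<And>n. (1 - of_real q ^ (n + 2)) * c (n + 2)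
      = a * of_real q ^ (n + 1) * c (n + 1) + b * of_real q ^ n * c n"
  shows "(\<lambda>N. \<Prod>k<N. 1 + a * (t * of_real q ^ k) + b * (t * of_real q ^ k)\<^sup>2)
    \<longlonglongrightarrow> (\<Sum>n. c n * t ^ n)"
proof -
  define f where "f t = (\<Sum>n. c n * t ^ n)" for t
  define P where "P N = (\<Prod>k<N. 1 + a * (t * of_real q ^ k) + b * (t * of_real q ^ k)\<^sup>2)" for N
  have Pf: "f t = P N * f (t * of_real q ^ N)" for N
  proof (induction N)
    case (Suc N)
    have "f (t * of_real q ^ N)
        = (1 + a * (t * of_real q ^ N) + b * (t * of_real q ^ N)\<^sup>2) * f (of_real q * (t * of_real q ^ N))"
      unfolding f_def by (rule recurrence_powser_functional_equation[OF q rec1 rec])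
    then show ?case
      using Suc by (simp add: P_def mult_ac)
  qed (simp add: P_def)
  have "isCont f 0"
    unfolding f_def
    by (intro isCont_powser_converges_everywhere recurrence_summable(1)[OF q rec])
  moreover have "f 0 = 1" using \<open>c 0 = 1\<close> by (simp add: f_def)
  moreover have "(\<lambda>N. t * of_real q ^ N) \<longlonglongrightarrow> 0"
    using q by (intro tendsto_mult_right_zero LIMSEQ_power_zero) auto
  ultimately have lim: "(\<lambda>N. f (t * of_real q ^ N)) \<longlonglongrightarrow> 1"
    using isCont_tendsto_compose by metis
  \<comment> \<open>A single f(t q^N) may vanish, so the quotient equals P N only eventually; this
    suffices for the limit.\<close>
  then have "(\<lambda>N. f t / f (t * of_real q ^ N)) \<longlonglongrightarrow> f t / 1"
    by (intro tendsto_intros) auto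
  moreover have "\<forall>\<^sub>F N in sequentially. f t / f (t * of_real q ^ N) = P N"
  proof -
    have "\<forall>\<^sub>F N in sequentially. f (t * of_real q ^ N) \<noteq> 0"
      using lim by (rule tendsto_imp_eventually_ne) simp
    then show ?thesis by eventually_elim (use Pf in \<open>simp add: field_simps\<close>)
  qed
  ultimately have "P \<longlonglongrightarrow> f t" using tendsto_cong by fastforce
  then show ?thesis unfolding P_def[abs_def] f_def .
qed

section \<open>Infinite q-shifted factorials and Euler's identity\<close>

lemma qpoch_inf_LIMSEQ:
  fixes a :: complex
  assumes "0 < q" "q < 1"
  shows "(\<lambda>N. \<Prod>k<N. 1 - a * of_real q ^ k) \<longlonglongrightarrow> qpoch_inf a (of_real q)"
proof -
  have "summable (\<lambda>k. norm (- a * of_real q ^ k))"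
    using assms by (simp add: norm_mult norm_power summable_mult summable_geometric)
  then have "convergent_prod (\<lambda>k. 1 + - a * of_real q ^ k)"
    by (intro abs_convergent_prod_imp_convergent_prod summable_imp_abs_convergent_prod) simp
  then have "(\<lambda>N. \<Prod>k\<le>N. 1 - a * of_real q ^ k) \<longlonglongrightarrow> qpoch_inf a (of_real q)"
    unfolding qpoch_inf_def using convergent_prod_LIMSEQ by fastforce
  then show ?thesis
    by (subst (asm) LIMSEQ_lessThan_iff_atMost[symmetric, where f = "prod (\<lambda>k. 1 - a * of_real q ^ k)"])
qed

text \<open>An absolutely convergent product vanishes only if one of its factors does.\<close>

lemma qpoch_inf_nonzero:
  fixes a :: complex
  assumes "0 < q" "q < 1" and "\<And>k. a * of_real q ^ k \<noteq> 1"
  shows "qpoch_inf a (of_real q) \<noteq> 0"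
proof -
  have "summable (\<lambda>k. norm (- a * of_real q ^ k))"
    using assms by (simp add: norm_mult norm_power summable_mult summable_geometric)
  then have "convergent_prod (\<lambda>k. 1 + - a * of_real q ^ k)"
    by (intro abs_convergent_prod_imp_convergent_prod summable_imp_abs_convergent_prod) simp
  then have "convergent_prod (\<lambda>k. 1 - a * of_real q ^ k)" by simp
  moreover have "1 - a * of_real q ^ k \<noteq> 0" for k
    using assms(3)[of k] by (metis right_minus_eq)
  ultimately show ?thesis
    unfolding qpoch_inf_def by (rule prodinf_nonzero)
qed

text \<open>The coefficient of z^n in Euler's expansion of (-z; q)_\<infinity>. The division by 2 is
  exact, and the truncated n - 1 does no harm at n = 0.\<close>

definition euler_coeff :: "real \<Rightarrow> nat \<Rightarrow> real" where
  "euler_coeff q n = q ^ (n * (n - 1) div 2) / qpoch q q n"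

lemma qpoch_Suc: "qpoch a q (Suc n) = qpoch a q n * (1 - a * q ^ n)"
  by (simp add: qpoch_def)

lemma qpoch_pos:
  fixes q :: real
  assumes "0 < q" "q < 1"
  shows "qpoch q q n > 0"
  using assms power_Suc_less_one[OF assms]
  by (induction n) (simp_all add: qpoch_Suc, simp add: qpoch_def)

lemma triangular_Suc: "Suc n * (Suc n - 1) div 2 = n * (n - 1) div 2 + n"
  by (cases n) (auto simp: algebra_simps)

lemma euler_coeff_0 [simp]: "euler_coeff q 0 = 1"
  by (simp add: euler_coeff_def qpoch_def)

lemma euler_coeff_Suc:
  assumes "0 < q" "q < 1"
  shows "(1 - q ^ Suc n) * euler_coeff q (Suc n) = q ^ n * euler_coeff q n"
  using qpoch_pos[OF assms, of n] power_Suc_less_one[OF assms, of n]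
  unfolding euler_coeff_def triangular_Suc qpoch_Suc
  by (simp add: field_simps power_add)

lemma euler_coeff_complex_rec:
  assumes "0 < q" "q < 1"
  shows "(1 - of_real q ^ Suc n) * complex_of_real (euler_coeff q (Suc n))
    = of_real q ^ n * of_real (euler_coeff q n)"
  using arg_cong[OF euler_coeff_Suc[OF assms, of n], of complex_of_real] by simp

text \<open>Euler's coefficients obey the general recurrence with a = 1 and b = 0, so convergence,
  product and q-shift all come from the facts on power series.\<close>

lemma
  fixes z :: complex
  assumes q: "0 < q" "q < 1"
  shows euler_summable: "summable (\<lambda>n. of_real (euler_coeff q n) * z ^ n)"
    and euler_identity: "(\<Sum>n. of_real (euler_coeff q n) * z ^ n) = qpoch_inf (- z) (of_real q)"
    and qpoch_inf_functional_equation: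
      "qpoch_inf (- z) (of_real q) = (1 + z) * qpoch_inf (- (of_real q * z)) (of_real q)"
proof -
  have rec1: "(1 - of_real q) * of_real (euler_coeff q 1) = (1 :: complex) * of_real (euler_coeff q 0)"
    using euler_coeff_complex_rec[OF q, of 0] by simp
  have rec: "(1 - of_real q ^ (n + 2)) * of_real (euler_coeff q (n + 2))
    = (1 :: complex) * of_real q ^ (n + 1) * of_real (euler_coeff q (n + 1))
      + 0 * of_real q ^ n * of_real (euler_coeff q n)" for n
    using euler_coeff_complex_rec[OF q, of "n + 1"] by simp
  show "summable (\<lambda>n. of_real (euler_coeff q n) * z ^ n)"
    using recurrence_summable(1)[OF q rec] .
  have *: "(\<Sum>n. of_real (euler_coeff q n) * z ^ n) = qpoch_inf (- z) (of_real q)" for z :: complex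
  proof -
    have "(\<lambda>N. \<Prod>k<N. 1 + 1 * (z * of_real q ^ k) + 0 * (z * of_real q ^ k)\<^sup>2)
        \<longlonglongrightarrow> (\<Sum>n. of_real (euler_coeff q n) * z ^ n)"
      using recurrence_powser_product[OF q _ rec1 rec] by simp
    moreover have "(\<lambda>N. \<Prod>k<N. 1 + 1 * (z * of_real q ^ k) + 0 * (z * of_real q ^ k)\<^sup>2)
        \<longlonglongrightarrow> qpoch_inf (- z) (of_real q)"
      using qpoch_inf_LIMSEQ[OF q, of "- z"] by simp
    ultimately show ?thesis by (rule LIMSEQ_unique)
  qed
  then show "(\<Sum>n. of_real (euler_coeff q n) * z ^ n) = qpoch_inf (- z) (of_real q)" .
  show "qpoch_inf (- z) (of_real q) = (1 + z) * qpoch_inf (- (of_real q * z)) (of_real q)"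
    using recurrence_powser_functional_equation[OF q rec1 rec, of z] unfolding * by simp
qed

section \<open>Generating function of the q^{-1}-Hermite polynomials\<close>

text \<open>The coefficient of t^n in \<chi>_t(x). The factor in front of h_n is the one that brings
  its recurrence into the general form, with a = 2 x and b = -1.\<close>

definition hermite_term :: "real \<Rightarrow> nat \<Rightarrow> real \<Rightarrow> real" where
  "hermite_term q n x = euler_coeff q n * poly (qinv_hermite q n) x"

lemma hermite_term_simps:
  assumes q: "0 < q" "q < 1"
  shows "hermite_term q 0 x = 1"
    and "(1 - q) * hermite_term q 1 x = 2 * x"
    and "(1 - q ^ (n + 2)) * hermite_term q (n + 2) x
      = 2 * x * q ^ (n + 1) * hermite_term q (n + 1) x - q ^ n * hermite_term q n x"
proof -
  show "hermite_term q 0 x = 1" by (simp add: hermite_term_def)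
  show "(1 - q) * hermite_term q 1 x = 2 * x"
  proof -
    have "(1 - q) * hermite_term q 1 x = ((1 - q ^ Suc 0) * euler_coeff q (Suc 0)) * (2 * x)"
      by (simp add: hermite_term_def)
    then show ?thesis unfolding euler_coeff_Suc[OF q] by simp
  qed
  have "(1 - q ^ (n + 2)) * hermite_term q (n + 2) x
      = ((1 - q ^ Suc (Suc n)) * euler_coeff q (Suc (Suc n))) * poly (qinv_hermite q (Suc (Suc n))) x"
    by (simp add: hermite_term_def)
  also have "\<dots> = q ^ Suc n * euler_coeff q (Suc n) * poly (qinv_hermite q (Suc (Suc n))) x"
    by (simp only: euler_coeff_Suc[OF q])
  also have "\<dots> = 2 * x * q ^ (n + 1) * hermite_term q (n + 1) x
      - ((1 - q ^ Suc n) * euler_coeff q (Suc n)) * poly (qinv_hermite q n) x"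
    using q by (simp add: hermite_term_def field_simps)
  also have "\<dots> = 2 * x * q ^ (n + 1) * hermite_term q (n + 1) x - q ^ n * hermite_term q n x"
    by (simp only: euler_coeff_Suc[OF q] hermite_term_def mult.assoc)
  finally show "(1 - q ^ (n + 2)) * hermite_term q (n + 2) x
      = 2 * x * q ^ (n + 1) * hermite_term q (n + 1) x - q ^ n * hermite_term q n x" .
qed

text \<open>For x = sinh \<xi> the numbers y = e^\<xi> and w = e^(-\<xi>) satisfy y w = 1 and y - w
  = 2 x. Hence the k-th factors of the two q-products in \<open>chi\<close> multiply to 1 + 2 x t
  q^k - (t q^k)^2, the factor belonging to a = 2 x and b = -1.\<close>

lemma
  assumes q: "0 < q" "q < 1"
  shows hermite_term_summable_sq: "R \<ge> 0 \<Longrightarrow> summable (\<lambda>n. (hermite_term q n x)\<^sup>2 * R ^ n)"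
    and chi_sums: "(\<lambda>n. of_real (hermite_term q n x) * t ^ n) sums chi q t x"
    and chi_shift: "chi q t x = (1 + 2 * of_real x * t - t\<^sup>2) * chi q (of_real q * t) x"
proof -
  let ?c = "\<lambda>n. complex_of_real (hermite_term q n x)"
  have c0: "?c 0 = 1" using hermite_term_simps[OF q] by simp
  have rec1: "(1 - of_real q) * ?c 1 = 2 * of_real x * ?c 0"
    using arg_cong[OF hermite_term_simps(2)[OF q, of x], of complex_of_real] c0 by simp
  have rec: "(1 - of_real q ^ (n + 2)) * ?c (n + 2)
      = 2 * of_real x * of_real q ^ (n + 1) * ?c (n + 1) + (- 1) * of_real q ^ n * ?c n" for n
    using arg_cong[OF hermite_term_simps(3)[OF q, of n x], of complex_of_real] by simp
  show "summable (\<lambda>n. (hermite_term q n x)\<^sup>2 * R ^ n)" if "R \<ge> 0"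
    using recurrence_summable(2)[OF q rec, of "of_real R"] that by simp
  have chi: "(\<Sum>n. ?c n * t ^ n) = chi q t x" for t
  proof -
    define y w where "y = sqrt (x\<^sup>2 + 1) + x" and "w = sqrt (x\<^sup>2 + 1) - x"
    have yw: "y * w = 1" "y - w = 2 * x"
      by (simp_all add: y_def w_def algebra_simps power2_eq_square[symmetric] add_nonneg_nonneg)
    have yw': "complex_of_real y * of_real w = 1" "complex_of_real y - of_real w = 2 * of_real x"
      using yw by (metis of_real_mult of_real_1, metis of_real_diff of_real_mult of_real_numeral)
    have fac: "(1 - (- t * of_real y) * p) * (1 - (t * of_real w) * p)
        = 1 + 2 * of_real x * (t * p) + (- 1) * (t * p)\<^sup>2" for p
    proof -
      have "(1 - (- t * of_real y) * p) * (1 - (t * of_real w) * p)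
        = 1 + (of_real y - of_real w) * (t * p) - (of_real y * of_real w) * (t * p)\<^sup>2"
        by (simp add: algebra_simps power2_eq_square)
      then show ?thesis unfolding yw' by simp
    qed
    have "(\<lambda>N. (\<Prod>k<N. 1 - (- t * of_real y) * of_real q ^ k) * (\<Prod>k<N. 1 - (t * of_real w) * of_real q ^ k))
        \<longlonglongrightarrow> chi q t x"
      unfolding chi_def y_def[symmetric] w_def[symmetric]
      by (intro tendsto_mult qpoch_inf_LIMSEQ q)
    then have "(\<lambda>N. \<Prod>k<N. 1 + 2 * of_real x * (t * of_real q ^ k) + (- 1) * (t * of_real q ^ k)\<^sup>2)
        \<longlonglongrightarrow> chi q t x"
      unfolding prod.distrib[symmetric] fac .
    then show ?thesis
      using recurrence_powser_product[OF q c0 rec1 rec, of t] LIMSEQ_unique by blast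
  qed
  show "(\<lambda>n. ?c n * t ^ n) sums chi q t x"
    using recurrence_summable(1)[OF q rec, of t] chi[of t] summable_sums by metis
  show "chi q t x = (1 + 2 * of_real x * t - t\<^sup>2) * chi q (of_real q * t) x"
    using recurrence_powser_functional_equation[OF q rec1 rec, of t] unfolding chi by simp
qed

section \<open>Al-Salam-Chihara polynomials: contiguous relation and degree\<close>

lemma alsalam_chihara_commute: "alsalam_chihara q s t n = alsalam_chihara q t s n"
  by (induction q s t n rule: alsalam_chihara.induct) (simp_all add: add.commute mult.commute)

lemma one_minus_power_nonzero:
  fixes q :: real
  assumes "0 < q" "q < 1"
  shows "1 - complex_of_real q ^ Suc n \<noteq> 0"
proof -
  have "q ^ Suc n \<noteq> 1" using power_Suc_less_one[OF assms, of n] by linarith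
  then have "complex_of_real (q ^ Suc n) \<noteq> 1" by (simp only: of_real_eq_1_iff not_False_eq_True)
  then show ?thesis by simp
qed

lemma alsalam_chihara_1:
  assumes "0 < q" "q < 1"
  shows "(1 - of_real q) * poly (alsalam_chihara q s t 1) x = 2 * x - (s + t) / of_real q"
proof -
  have "poly (alsalam_chihara q s t 1) x = 1 / (1 - of_real q) * (2 * x - (s + t) / of_real q)"
    by (simp add: add_divide_distrib diff_divide_distrib algebra_simps)
  then show ?thesis using one_minus_power_nonzero[OF assms, of 0] by simp
qed

lemma alsalam_chihara_rec:
  assumes "0 < q" "q < 1"
  shows "(1 - of_real q ^ (n + 2)) * poly (alsalam_chihara q s t (n + 2)) x
    = (2 * x * of_real q ^ (n + 1) - (s + t) / of_real q) * poly (alsalam_chihara q s t (n + 1)) x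
      - (s * t / (of_real q)\<^sup>2 + of_real q ^ n) * poly (alsalam_chihara q s t n) x"
proof -
  have "poly (alsalam_chihara q s t (n + 2)) x = 1 / (1 - of_real q ^ (n + 2)) *
    ((2 * x * of_real q ^ (n + 1) - (s + t) / of_real q) * poly (alsalam_chihara q s t (n + 1)) x
      - (s * t / (of_real q)\<^sup>2 + of_real q ^ n) * poly (alsalam_chihara q s t n) x)"
  proof -
    have "- (s + t) / of_real q + x * (2 * of_real q ^ (n + 1) + x * 0) = 2 * x * of_real q ^ (n + 1) - (s + t) / of_real q"
      by (simp add: add_divide_distrib diff_divide_distrib algebra_simps)
    then show ?thesis
      by (simp only: add_2_eq_Suc' Suc_eq_plus1[symmetric] alsalam_chihara.simps poly_smult poly_diff poly_mult poly_pCons poly_0)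
  qed
  then show ?thesis using one_minus_power_nonzero[OF assms, of "n + 1"] by simp
qed

text \<open>The quadratic factor is the one that turns \<chi>_s into \<chi>_(s/q), so against
  \<chi>_s \<chi>_t the left side becomes the functional at s/q. The identity holds because the
  right side, by the recurrence at s, satisfies the recurrence in n of the left side; comparing n =
  0 and n = 1 then suffices.\<close>

lemma alsalam_chihara_contiguous:
  fixes s t x :: complex
  assumes q: "0 < q" "q < 1"
  defines "Q \<equiv> complex_of_real q"
  shows "(1 + 2 * x * (s / Q) - (s / Q)\<^sup>2) * poly (alsalam_chihara q (s / Q) t n) x
    = s * (1 / Q ^ (n + 1) - 1) * poly (alsalam_chihara q s t (n + 1)) x
      + (1 + s * t / Q ^ (n + 2)) * poly (alsalam_chihara q s t n) x"
proof (induction n rule: less_induct)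
  case (less n)
  have Q: "Q \<noteq> 0" using q by (simp add: Q_def)
  define a b where "a n = poly (alsalam_chihara q s t n) x"
    and "b n = poly (alsalam_chihara q (s / Q) t n) x" for n
  \<comment> \<open>Substituting \<open>t = \<tau> Q\<close> and \<open>s = \<sigma> Q\<^sup>k\<close> (for suitable \<open>k\<close>) clears all denominators, so that the claim becomes a
    polynomial consequence of the recurrences.\<close>
  define \<tau> where "\<tau> = t / Q"
  have \<tau>: "t = \<tau> * Q" using Q by (simp add: \<tau>_def)
  have a0: "a 0 = 1" and b0: "b 0 = 1" by (simp_all add: a_def b_def)
  have a1: "(1 - Q) * a 1 = 2 * x - (s + t) / Q" 
    and b1: "(1 - Q) * b 1 = 2 * x - (s / Q + t) / Q"
    unfolding a_def b_def Q_def by (rule alsalam_chihara_1[OF q])+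
  have rec_a: "(1 - Q ^ (n + 2)) * a (n + 2)
      = (2 * x * Q ^ (n + 1) - (s + t) / Q) * a (n + 1) - (s * t / Q\<^sup>2 + Q ^ n) * a n" for n
    unfolding a_def Q_def by (rule alsalam_chihara_rec[OF q])
  have rec_b: "(1 - Q ^ (n + 2)) * b (n + 2)
      = (2 * x * Q ^ (n + 1) - (s / Q + t) / Q) * b (n + 1) - (s / Q * t / Q\<^sup>2 + Q ^ n) * b n" for n
    unfolding b_def Q_def by (rule alsalam_chihara_rec[OF q])
  note Q1 = one_minus_power_nonzero[OF q, folded Q_def]
  have IH: "(1 + 2 * x * (s / Q) - (s / Q)\<^sup>2) * b m
    = s * (1 / Q ^ (m + 1) - 1) * a (m + 1) + (1 + s * t / Q ^ (m + 2)) * a m" if "m < n" for m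
    using less.IH[OF that] by (simp add: a_def b_def)
  consider "n = 0" | "n = 1" | m where "n = m + 2"
    by (metis One_nat_def add_2_eq_Suc' not0_implies_Suc)
  then have "(1 + 2 * x * (s / Q) - (s / Q)\<^sup>2) * b n
    = s * (1 / Q ^ (n + 1) - 1) * a (n + 1) + (1 + s * t / Q ^ (n + 2)) * a n"
  proof cases
    case 1
    have "s * (1 / Q - 1) * a 1 = s / Q * ((1 - Q) * a 1)"
      using Q by (simp add: field_simps)
    then show ?thesis unfolding 1 using Q by (simp add: a0 b0 a1[simplified] field_simps power2_eq_square)
  next
    case 2
    \<comment> \<open>The exponent is n + 2, as in the next case: s t / Q^(n+2) has the largest
      denominator that occurs.\<close>
    define \<sigma> where "\<sigma> = s / Q ^ 3"
    have \<sigma>: "s = \<sigma> * Q ^ 3" using Q by (simp add: \<sigma>_def)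
    have st: "(s + t) / Q = \<sigma> * Q\<^sup>2 + \<tau>" "(s / Q + t) / Q = \<sigma> * Q + \<tau>" "s * t / Q\<^sup>2 = \<sigma> * \<tau> * Q\<^sup>2"
      using Q by (simp_all add: \<sigma> \<tau> field_simps eval_nat_numeral)
    note 3 = b1[unfolded st] and 4 = a1[unfolded st]
    have 5: "(1 - Q\<^sup>2) * a 2 = (2 * x * Q - (\<sigma> * Q\<^sup>2 + \<tau>)) * a 1 - (\<sigma> * \<tau> * Q\<^sup>2 + 1)"
      using rec_a[of 0] a0 unfolding st by (simp add: numeral_2_eq_2)
    \<comment> \<open>The recurrence determines \<open>a 1\<close> and \<open>b 1\<close> only
      through their multiples by 1 - Q, so that factor is kept for the polynomial identity and
      cancelled afterwards.\<close>
    have "(1 - Q) * ((1 + 2 * x * (\<sigma> * Q\<^sup>2) - (\<sigma> * Q\<^sup>2)\<^sup>2) * b 1)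
      = (1 - Q) * (\<sigma> * Q * (1 - Q\<^sup>2) * a 2 + (1 + \<sigma> * \<tau> * Q) * a 1)"
      using 3 4 5 by algebra
    then have "(1 + 2 * x * (\<sigma> * Q\<^sup>2) - (\<sigma> * Q\<^sup>2)\<^sup>2) * b 1
      = \<sigma> * Q * (1 - Q\<^sup>2) * a 2 + (1 + \<sigma> * \<tau> * Q) * a 1"
      using Q1[of 0] by simp
    moreover have "s / Q = \<sigma> * Q\<^sup>2" "s * (1 / Q\<^sup>2 - 1) = \<sigma> * Q * (1 - Q\<^sup>2)" "s * t / Q ^ 3 = \<sigma> * \<tau> * Q"
      using Q by (simp_all add: \<sigma> \<tau> field_simps eval_nat_numeral)
    moreover have "(1::nat) + 1 = 2" "(1::nat) + 2 = 3" by simp_all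
    ultimately show ?thesis unfolding 2 by (simp only:)
  next
    case 3
    define P where "P = Q ^ m"
    have P: "P \<noteq> 0" using Q by (simp add: P_def)
    define \<sigma> where "\<sigma> = s / (Q ^ 4 * P)"
    have \<sigma>: "s = \<sigma> * Q ^ 4 * P" using Q P by (simp add: \<sigma>_def)
    have pw: "Q ^ (m + 1) = Q * P" "Q ^ (m + 2) = Q\<^sup>2 * P" "Q ^ (m + 3) = Q ^ 3 * P" "Q ^ (m + 4) = Q ^ 4 * P"
      unfolding P_def power_add by (simp_all only: power_one_right mult.commute)
    have ar: "m + 1 + 1 = m + 2" "m + 1 + 2 = m + 3" "m + 2 + 1 = m + 3" "m + 2 + 2 = m + 4" by simp_all
    define A where "A = 1 + 2 * x * (\<sigma> * Q ^ 3 * P) - (\<sigma> * Q ^ 3 * P)\<^sup>2"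
    have sQ: "s / Q = \<sigma> * Q ^ 3 * P" using Q by (simp add: \<sigma> eval_nat_numeral)
    have A: "1 + 2 * x * (s / Q) - (s / Q)\<^sup>2 = A" unfolding sQ A_def ..
    have "A * b m = s * (1 / (Q * P) - 1) * a (m + 1) + (1 + s * t / (Q\<^sup>2 * P)) * a m"
      using IH[of m] 3 unfolding A pw by simp
    moreover have "s * (1 / (Q * P) - 1) = \<sigma> * Q ^ 3 * (1 - Q * P)" "s * t / (Q\<^sup>2 * P) = \<sigma> * \<tau> * Q ^ 3"
      using Q P by (simp_all add: \<sigma> \<tau> field_simps eval_nat_numeral)
    ultimately have E0: "A * b m = \<sigma> * Q ^ 3 * (1 - Q * P) * a (m + 1) + (1 + \<sigma> * \<tau> * Q ^ 3) * a m"
      by simp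
    have "A * b (m + 1) = s * (1 / (Q\<^sup>2 * P) - 1) * a (m + 2) + (1 + s * t / (Q ^ 3 * P)) * a (m + 1)"
      using IH[of "m + 1"] 3 unfolding A ar pw by simp
    moreover have "s * (1 / (Q\<^sup>2 * P) - 1) = \<sigma> * Q\<^sup>2 * (1 - Q\<^sup>2 * P)" "s * t / (Q ^ 3 * P) = \<sigma> * \<tau> * Q\<^sup>2"
      using Q P by (simp_all add: \<sigma> \<tau> field_simps eval_nat_numeral)
    ultimately have E1: "A * b (m + 1) = \<sigma> * Q\<^sup>2 * (1 - Q\<^sup>2 * P) * a (m + 2) + (1 + \<sigma> * \<tau> * Q\<^sup>2) * a (m + 1)"
      by simp
    have st: "(s + t) / Q = \<sigma> * Q ^ 3 * P + \<tau>" "(s / Q + t) / Q = \<sigma> * Q\<^sup>2 * P + \<tau>"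
        "s * t / Q\<^sup>2 = \<sigma> * \<tau> * Q ^ 3 * P" "s / Q * t / Q\<^sup>2 = \<sigma> * \<tau> * Q\<^sup>2 * P"
      using Q P by (simp_all add: \<sigma> \<tau> field_simps eval_nat_numeral)
    have B2: "(1 - Q\<^sup>2 * P) * b (m + 2) = (2 * x * Q * P - (\<sigma> * Q\<^sup>2 * P + \<tau>)) * b (m + 1) - (\<sigma> * \<tau> * Q\<^sup>2 * P + P) * b m"
      using rec_b[of m] unfolding st pw P_def[symmetric] by (simp add: mult_ac)
    have A2: "(1 - Q\<^sup>2 * P) * a (m + 2) = (2 * x * Q * P - (\<sigma> * Q ^ 3 * P + \<tau>)) * a (m + 1) - (\<sigma> * \<tau> * Q ^ 3 * P + P) * a m"
      using rec_a[of m] unfolding st pw P_def[symmetric] by (simp add: mult_ac)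
    have A3: "(1 - Q ^ 3 * P) * a (m + 3) = (2 * x * Q\<^sup>2 * P - (\<sigma> * Q ^ 3 * P + \<tau>)) * a (m + 2) - (\<sigma> * \<tau> * Q ^ 3 * P + Q * P) * a (m + 1)"
      using rec_a[of "m + 1"] unfolding ar st pw by (simp only: mult.assoc)
    have "(1 - Q\<^sup>2 * P) * (A * b (m + 2))
      = (1 - Q\<^sup>2 * P) * (\<sigma> * Q * (1 - Q ^ 3 * P) * a (m + 3) + (1 + \<sigma> * \<tau> * Q) * a (m + 2))"
      (is "?l = ?r")
    proof -
      have "?l = (2 * x * Q * P - (\<sigma> * Q\<^sup>2 * P + \<tau>)) * (A * b (m + 1)) - (\<sigma> * \<tau> * Q\<^sup>2 * P + P) * (A * b m)"
        using B2 by algebra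
      also have "\<dots> = ?r"
        unfolding E0 E1 using A2 A3 by algebra
      finally show ?thesis .
    qed
    then have "A * b (m + 2) = \<sigma> * Q * (1 - Q ^ 3 * P) * a (m + 3) + (1 + \<sigma> * \<tau> * Q) * a (m + 2)"
      using Q1[of "m + 1"] pw by simp
    moreover have "s * (1 / (Q ^ 3 * P) - 1) = \<sigma> * Q * (1 - Q ^ 3 * P)" "s * t / (Q ^ 4 * P) = \<sigma> * \<tau> * Q"
      using Q P by (simp_all add: \<sigma> \<tau> field_simps eval_nat_numeral)
    ultimately show ?thesis unfolding 3 A by (simp only: ar pw)
  qed
  then show ?case by (simp add: a_def b_def)
qed

lemma degree_alsalam_chihara:
  assumes q: "0 < q" "q < 1"
  shows "degree (alsalam_chihara q s t n) = n"
proof (induction n rule: less_induct)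
  case (less n)
  have Q: "complex_of_real q \<noteq> 0" using q by simp
  consider "n = 0" | "n = 1" | m where "n = Suc (Suc m)"
    by (metis One_nat_def not0_implies_Suc)
  then show ?case
  proof cases
    case (3 m)
    let ?p = "[:- (s + t) / of_real q, 2 * of_real q ^ (m + 1):] * alsalam_chihara q s t (Suc m)"
    have d: "degree (alsalam_chihara q s t (Suc m)) = Suc m" "degree (alsalam_chihara q s t m) = m"
      using less 3 by simp_all
    then have "alsalam_chihara q s t (Suc m) \<noteq> 0" by force
    then have "degree ?p = m + 2"
      using Q d(1) by (subst degree_mult_eq) (simp_all del: alsalam_chihara.simps)
    moreover have "degree (- smult (s * t / (of_real q)\<^sup>2 + of_real q ^ m) (alsalam_chihara q s t m)) < m + 2"
      using degree_smult_le[of _ "alsalam_chihara q s t m"] d(2) by (simp add: less_Suc_eq_le le_SucI)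
    ultimately have "degree (?p + - smult (s * t / (of_real q)\<^sup>2 + of_real q ^ m) (alsalam_chihara q s t m)) = m + 2"
      by (subst degree_add_eq_left) simp_all
    then show ?thesis
      using one_minus_power_nonzero[OF q, of "m + 1"] unfolding 3 alsalam_chihara.simps by simp
  qed (use one_minus_power_nonzero[OF q, of 0] in simp_all)
qed

section \<open>Multiplication by x and orthogonality for a linear functional\<close>

text \<open>The recurrence solved for x u_n, showing that multiplication by x is tridiagonal. The
  case distinction stands for u_{-1} = 0, since n - 1 is 0 at n = 0.\<close>

lemma alsalam_chihara_poly_rec:
  assumes q: "0 < q" "q < 1"
  shows "smult (2 * of_real q ^ n) (pCons 0 (alsalam_chihara q s t n))
    = smult (1 - of_real q ^ (n + 1)) (alsalam_chihara q s t (n + 1))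
      + smult ((s + t) / of_real q) (alsalam_chihara q s t n)
      + (if n = 0 then 0 else smult (s * t / (of_real q)\<^sup>2 + of_real q ^ (n - 1)) (alsalam_chihara q s t (n - 1)))"
proof (rule poly_ext)
  fix x
  show "poly (smult (2 * of_real q ^ n) (pCons 0 (alsalam_chihara q s t n))) x
    = poly (smult (1 - of_real q ^ (n + 1)) (alsalam_chihara q s t (n + 1))
      + smult ((s + t) / of_real q) (alsalam_chihara q s t n)
      + (if n = 0 then 0 else smult (s * t / (of_real q)\<^sup>2 + of_real q ^ (n - 1)) (alsalam_chihara q s t (n - 1)))) x"
  proof (cases n)
    case 0
    then show ?thesis using alsalam_chihara_1[OF q, of s t x] by (simp add: algebra_simps)
  next
    case (Suc m)
    have "poly (smult (1 - of_real q ^ (n + 1)) (alsalam_chihara q s t (n + 1))) x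
      = (1 - of_real q ^ (m + 2)) * poly (alsalam_chihara q s t (m + 2)) x"
      by (simp add: Suc del: alsalam_chihara.simps)
    then show ?thesis unfolding alsalam_chihara_rec[OF q] poly_add
      by (simp add: Suc algebra_simps del: alsalam_chihara.simps)
  qed
qed

text \<open>Multiplication by x moves the index by at most one. So for k < n, x^k u_n is a
  combination of u_j with j \<ge> 1 and is annihilated, while L (x^n u_n) is L 1 times factors
  proportional to s t / q^2 + q^j with 0 \<le> j < n. The condition on s t, whose exponents start at
  2, says that none of these factors is 0.\<close>

lemma alsalam_chihara_functional_orthogonal:
  fixes L :: "complex poly \<Rightarrow> complex"
  assumes q: "0 < q" "q < 1"
    and add: "\<And>p r. L (p + r) = L p + L r"
    and smult: "\<And>c p. L (smult c p) = c * L p"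
    and vanish: "\<And>n. n \<ge> 1 \<Longrightarrow> L (alsalam_chihara q s t n) = 0"
    and "L 1 \<noteq> 0"
    and st: "\<And>n::nat. n \<ge> 1 \<Longrightarrow> s * t \<noteq> - of_real (q ^ (n + 1))"
  shows "m \<noteq> n \<Longrightarrow> L (alsalam_chihara q s t m * alsalam_chihara q s t n) = 0"
    and "L ((alsalam_chihara q s t n)\<^sup>2) \<noteq> 0"
proof -
  let ?u = "alsalam_chihara q s t"
  have zero: "L 0 = 0" using smult[of 0 0] by simp
  have sum: "L (sum f A) = (\<Sum>i\<in>A. L (f i))" for f and A :: "nat set"
    by (induction A rule: infinite_finite_induct) (simp_all add: zero add)
  define M where "M k n = L (monom 1 k * ?u n)" for k n
  have M_Suc: "2 * of_real q ^ n * M (Suc k) n = (1 - of_real q ^ (n + 1)) * M k (n + 1)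
      + (s + t) / of_real q * M k n
      + (if n = 0 then 0 else (s * t / (of_real q)\<^sup>2 + of_real q ^ (n - 1)) * M k (n - 1))" for k n
  proof -
    have "2 * of_real q ^ n * M (Suc k) n = L (monom 1 k * smult (2 * of_real q ^ n) (pCons 0 (?u n)))"
      unfolding M_def smult[symmetric] by (simp add: monom_Suc)
    then show ?thesis
      unfolding alsalam_chihara_poly_rec[OF q]
      by (simp add: M_def ring_distribs add smult zero del: alsalam_chihara.simps)
  qed
  have M0: "M k n = 0" if "k < n" for k n
    using that
  proof (induction k arbitrary: n)
    case 0
    then show ?case using vanish by (simp add: M_def monom_0)
  next
    case (Suc k)
    then have "2 * of_real q ^ n * M (Suc k) n = 0" unfolding M_Suc by simp
    then show ?case using q by simp
  qed
  have M1: "M n n \<noteq> 0" for n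
  proof (induction n)
    case 0
    then show ?case using \<open>L 1 \<noteq> 0\<close> by (simp add: M_def flip: one_pCons)
  next
    case (Suc n)
    have "s * t \<noteq> - (of_real q)\<^sup>2 * of_real q ^ n" using st[of "n + 1"] by (simp add: power2_eq_square mult_ac)
    then have "s * t / (of_real q)\<^sup>2 + of_real q ^ n \<noteq> 0"
      using q by (simp add: add_eq_0_iff2 divide_eq_eq mult_ac)
    moreover have "2 * of_real q ^ Suc n * M (Suc n) (Suc n) = (s * t / (of_real q)\<^sup>2 + of_real q ^ n) * M n n"
      unfolding M_Suc by (simp add: M0)
    ultimately show ?case using Suc by auto
  qed
  have expand: "L (p * ?u n) = (\<Sum>i\<le>degree p. coeff p i * M i n)" for p n
  proof -
    have "L (p * ?u n) = L ((\<Sum>i\<le>degree p. monom (coeff p i) i) * ?u n)"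
      by (simp only: poly_as_sum_of_monoms)
    also have "\<dots> = (\<Sum>i\<le>degree p. L (smult (coeff p i) (monom 1 i * ?u n)))"
      by (simp add: sum_distrib_right sum smult_monom flip: mult_smult_left)
    finally show ?thesis by (simp add: M_def smult)
  qed
  have less: "L (?u m * ?u n) = 0" if "m < n" for m n
    unfolding expand using that M0 by (intro sum.neutral) (simp add: degree_alsalam_chihara[OF q])
  show "m \<noteq> n \<Longrightarrow> L (?u m * ?u n) = 0"
    using less[of m n] less[of n m] by (cases m n rule: linorder_cases) (simp_all add: mult.commute)
  have "L (?u n * ?u n) = coeff (?u n) n * M n n"
    unfolding expand degree_alsalam_chihara[OF q] using M0
    by (subst sum.remove[of _ n]) (auto intro!: sum.neutral)
  moreover have "coeff (?u n) n \<noteq> 0"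
  proof (cases n)
    case (Suc m)
    then show ?thesis using degree_alsalam_chihara[OF q, of s t n] by (metis degree_0 leading_coeff_0_iff nat.distinct(1))
  qed simp
  ultimately show "L ((?u n)\<^sup>2) \<noteq> 0" using M1 by (simp add: power2_eq_square)
qed

section \<open>Specialization to s = t = 0\<close>

lemma chi_0 [simp]: "chi q 0 x = 1"
  by (simp add: chi_def qpoch_inf_def)

text \<open>At s = 0 the contiguous relation degenerates to u_n = u_n. When both parameters vanish,
  this identification links u_n directly to the orthogonality relations of \<mu>.\<close>

lemma alsalam_chihara_0_0:
  assumes q: "0 < q" "q < 1"
  shows "poly (alsalam_chihara q 0 0 n) (of_real x) = of_real (hermite_term q n x)"
proof (induction n rule: less_induct)
  case (less n)
  consider "n = 0" | "n = 1" | m where "n = m + 2"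
    by (metis One_nat_def add_2_eq_Suc' not0_implies_Suc)
  then show ?case
  proof cases
    case 1
    then show ?thesis by (simp add: hermite_term_simps(1)[OF q])
  next
    case 2
    have "(1 - of_real q) * poly (alsalam_chihara q 0 0 1) (of_real x)
        = (1 - of_real q) * complex_of_real (hermite_term q 1 x)"
      using alsalam_chihara_1[OF q, of 0 0 "of_real x"]
        arg_cong[OF hermite_term_simps(2)[OF q, of x], of complex_of_real] by simp
    then show ?thesis using one_minus_power_nonzero[OF q, of 0] 2 by simp
  next
    case (3 m)
    have "(1 - of_real q ^ (m + 2)) * poly (alsalam_chihara q 0 0 (m + 2)) (of_real x)
        = (1 - of_real q ^ (m + 2)) * complex_of_real (hermite_term q (m + 2) x)"
      unfolding alsalam_chihara_rec[OF q]
      using arg_cong[OF hermite_term_simps(3)[OF q, of m x], of complex_of_real]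
        less.IH[of m] less.IH[of "m + 1"] 3 by simp
    then show ?thesis using one_minus_power_nonzero[OF q, of "m + 1"] 3 by simp
  qed
qed

section \<open>Integration against a measure of the class\<close>

locale qinv_hermite_measure =
  fixes q :: real and \<mu> :: "real measure"
  assumes q: "0 < q" "q < 1" and mem: "\<mu> \<in> qinv_hermite_measures q"
begin

lemma sets_eq [measurable_cong, simp]: "sets \<mu> = sets borel"
  and integrable_power: "integrable \<mu> (\<lambda>x. x ^ n)"
  using mem by (simp_all add: qinv_hermite_measures_def)

lemma integrable_poly:
  fixes p :: "real poly"
  shows "integrable \<mu> (\<lambda>x. poly p x)"
  unfolding poly_altdef by (intro Bochner_Integration.integrable_sum integrable_mult_right integrable_power)

text \<open>With E_n for \<open>euler_coeff q n\<close>, the squared norm E_n^2 (q; q)_n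
  q^(-n(n+1)/2) simplifies to E_n q^(-n). This q^(-n) is the origin of the quotient s t / q in the
  total mass.\<close>

lemma hermite_term_orthogonal:
  shows "integrable \<mu> (\<lambda>x. hermite_term q m x * hermite_term q n x)"
    and "(\<integral>x. hermite_term q m x * hermite_term q n x \<partial>\<mu>) = (if m = n then euler_coeff q n / q ^ n else 0)"
proof -
  have eq: "(\<lambda>x. hermite_term q m x * hermite_term q n x)
      = (\<lambda>x. euler_coeff q m * euler_coeff q n * (poly (qinv_hermite q m) x * poly (qinv_hermite q n) x))"
    by (simp add: hermite_term_def mult_ac)
  show "integrable \<mu> (\<lambda>x. hermite_term q m x * hermite_term q n x)"
    unfolding eq by (intro integrable_mult_right) (use integrable_poly[of "qinv_hermite q m * qinv_hermite q n"] in simp)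
  have "(\<integral>x. hermite_term q m x * hermite_term q n x \<partial>\<mu>)
      = (if m = n then (euler_coeff q n)\<^sup>2 * (qpoch q q n / q ^ (n * (n + 1) div 2)) else 0)"
    using mem unfolding eq by (simp add: qinv_hermite_measures_def power2_eq_square)
  moreover have "(euler_coeff q n)\<^sup>2 * (qpoch q q n / q ^ (n * (n + 1) div 2)) = euler_coeff q n / q ^ n"
  proof -
    have "n * (n + 1) div 2 = n * (n - 1) div 2 + n" using triangular_Suc[of n] by (simp add: mult.commute)
    then show ?thesis using qpoch_pos[OF q, of n] q
      by (simp add: euler_coeff_def power_add power2_eq_square)
  qed
  ultimately show "(\<integral>x. hermite_term q m x * hermite_term q n x \<partial>\<mu>) = (if m = n then euler_coeff q n / q ^ n else 0)"
    by simp
qed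

definition hermite_sum :: "complex \<Rightarrow> nat \<Rightarrow> real \<Rightarrow> complex" where
  "hermite_sum t N x = (\<Sum>n<N. of_real (hermite_term q n x) * t ^ n)"

lemma hermite_sum_LIMSEQ: "(\<lambda>N. hermite_sum t N x) \<longlonglongrightarrow> chi q t x"
  using chi_sums[OF q, of x t] by (simp add: sums_def hermite_sum_def)

lemma hermite_term_measurable [measurable]: "hermite_term q n \<in> borel_measurable borel"
  unfolding hermite_term_def by (intro borel_measurable_continuous_onI continuous_intros)

lemma hermite_sum_measurable [measurable]: "hermite_sum t N \<in> borel_measurable borel"
  unfolding hermite_sum_def by measurable

lemma chi_measurable [measurable]: "chi q t \<in> borel_measurable borel"
  by (rule borel_measurable_LIMSEQ_metric[OF hermite_sum_measurable hermite_sum_LIMSEQ])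

text \<open>The square-integrable majorant of the partial sums comes from the Cauchy-Schwarz inequality
  with weights \<open>2\<^sup>n\<close>.\<close>

definition hermite_majorant :: "complex \<Rightarrow> real \<Rightarrow> real" where
  "hermite_majorant t x = (\<Sum>n. (hermite_term q n x)\<^sup>2 * (2 * (norm t)\<^sup>2) ^ n)"

text \<open>With R = 2 |t|^2 the integrals of the terms are E_n (R/q)^n, where E_n is
  \<open>euler_coeff q n\<close>. This is Euler's series at R/q, which converges for every
  R.\<close>

lemma integrable_hermite_majorant: "integrable \<mu> (hermite_majorant t)"
proof -
  define R where "R = 2 * (norm t)\<^sup>2"
  have R: "R \<ge> 0" by (simp add: R_def)
  have int: "integrable \<mu> (\<lambda>x. (hermite_term q n x)\<^sup>2 * R ^ n)" for n
    using hermite_term_orthogonal(1)[of n n] by (simp add: power2_eq_square)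
  have "(\<integral>x. (hermite_term q n x)\<^sup>2 * R ^ n \<partial>\<mu>) = euler_coeff q n * (R / q) ^ n" for n
    using hermite_term_orthogonal(2)[of n n] by (simp add: power2_eq_square power_divide)
  moreover have "summable (\<lambda>n. euler_coeff q n * (R / q) ^ n)"
  proof -
    have "(\<lambda>n. complex_of_real (euler_coeff q n) * of_real (R / q) ^ n)
      = (\<lambda>n. of_real (euler_coeff q n * (R / q) ^ n))" by simp
    then show ?thesis
      using euler_summable[OF q, of "of_real (R / q)"] by (simp only: summable_of_real_iff)
  qed
  ultimately have "summable (\<lambda>n. \<integral>x. norm ((hermite_term q n x)\<^sup>2 * R ^ n) \<partial>\<mu>)"
    using R by simp
  moreover have "summable (\<lambda>n. norm ((hermite_term q n x)\<^sup>2 * R ^ n))" for x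
    using hermite_term_summable_sq[OF q R, of x] R by simp
  ultimately show ?thesis
    using integrable_suminf[of \<mu> "\<lambda>n x. (hermite_term q n x)\<^sup>2 * R ^ n"] int
    by (simp add: hermite_majorant_def[abs_def] R_def)
qed

lemma norm_hermite_sum_sq_le: "(norm (hermite_sum t N x))\<^sup>2 \<le> 2 * hermite_majorant t x"
proof -
  define R where "R = 2 * (norm t)\<^sup>2"
  have R: "R \<ge> 0" by (simp add: R_def)
  have "norm (hermite_sum t N x) \<le> (\<Sum>n<N. \<bar>hermite_term q n x\<bar> * norm t ^ n)"
    unfolding hermite_sum_def by (rule sum_norm_le) (simp add: norm_mult norm_power)
  \<comment> \<open>Splitting 1 = 2^(-n/2) 2^(n/2) produces both the geometric sum, at most 2, and
    the base 2 |t|^2 of the majorant.\<close>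
  also have "\<dots> = (\<Sum>n<N. sqrt (1 / 2) ^ n * (\<bar>hermite_term q n x\<bar> * (sqrt 2 * norm t) ^ n))"
    by (intro sum.cong) (simp_all add: power_mult_distrib real_sqrt_divide power_divide)
  finally have "(norm (hermite_sum t N x))\<^sup>2
      \<le> (\<Sum>n<N. sqrt (1 / 2) ^ n * (\<bar>hermite_term q n x\<bar> * (sqrt 2 * norm t) ^ n))\<^sup>2"
    by (intro power_mono) auto
  also have "\<dots> \<le> (\<Sum>n<N. (sqrt (1 / 2) ^ n)\<^sup>2) * (\<Sum>n<N. (\<bar>hermite_term q n x\<bar> * (sqrt 2 * norm t) ^ n)\<^sup>2)"
    by (rule Cauchy_Schwarz_ineq_sum)
  also have "(\<Sum>n<N. (sqrt (1 / 2) ^ n)\<^sup>2) = (\<Sum>n<N. (1 / 2) ^ n)"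
    by (intro sum.cong refl) (metis power_even_eq power_mult real_sqrt_pow2 zero_le_divide_1_iff zero_le_numeral)
  also have "(\<Sum>n<N. (\<bar>hermite_term q n x\<bar> * (sqrt 2 * norm t) ^ n)\<^sup>2) = (\<Sum>n<N. (hermite_term q n x)\<^sup>2 * R ^ n)"
  proof (intro sum.cong refl)
    fix n
    have "((sqrt 2 * norm t) ^ n)\<^sup>2 = ((sqrt 2 * norm t)\<^sup>2) ^ n" by (simp only: power_mult[symmetric] mult.commute)
    then show "(\<bar>hermite_term q n x\<bar> * (sqrt 2 * norm t) ^ n)\<^sup>2 = (hermite_term q n x)\<^sup>2 * R ^ n"
      by (simp add: R_def power_mult_distrib)
  qed
  also have "(\<Sum>n<N. (1 / 2 :: real) ^ n) * (\<Sum>n<N. (hermite_term q n x)\<^sup>2 * R ^ n) \<le> 2 * hermite_majorant t x"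
  proof (rule mult_mono)
    have "(\<Sum>n<N. (1 / 2 :: real) ^ n) \<le> (\<Sum>n. (1 / 2) ^ n)"
      by (intro sum_le_suminf summable_geometric) auto
    then show "(\<Sum>n<N. (1 / 2 :: real) ^ n) \<le> 2" by (simp add: suminf_geometric)
    show "(\<Sum>n<N. (hermite_term q n x)\<^sup>2 * R ^ n) \<le> hermite_majorant t x"
      unfolding hermite_majorant_def R_def[symmetric]
      using R by (intro sum_le_suminf hermite_term_summable_sq[OF q]) auto
  qed (use R in \<open>auto intro!: sum_nonneg\<close>)
  finally show ?thesis .
qed

text \<open>Orthogonality collapses the double sum for the partial sums to a partial sum of Euler's
  series at s t / q. The inequality 2 |a b| \<le> |a|^2 + |b|^2 yields a dominating function
  independent of N.\<close>

lemma
  shows integrable_chi_chi: "integrable \<mu> (\<lambda>x. chi q s x * chi q t x)"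
    and integral_chi_chi: "(\<integral>x. chi q s x * chi q t x \<partial>\<mu>) = qpoch_inf (- (s * t) / of_real q) (of_real q)"
proof -
  let ?S = "\<lambda>N x. hermite_sum s N x * hermite_sum t N x"
  have bound: "norm (?S N x) \<le> hermite_majorant s x + hermite_majorant t x" for N x
  proof -
    have "2 * norm (hermite_sum s N x) * norm (hermite_sum t N x)
        \<le> (norm (hermite_sum s N x))\<^sup>2 + (norm (hermite_sum t N x))\<^sup>2"
      by (rule sum_squares_bound)
    then show ?thesis
      using norm_hermite_sum_sq_le[of s N x] norm_hermite_sum_sq_le[of t N x]
      unfolding norm_mult by linarith
  qed
  have w: "integrable \<mu> (\<lambda>x. hermite_majorant s x + hermite_majorant t x)"
    by (intro Bochner_Integration.integrable_add integrable_hermite_majorant)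
  have lim: "AE x in \<mu>. (\<lambda>N. ?S N x) \<longlonglongrightarrow> chi q s x * chi q t x"
    by (intro AE_I2 tendsto_mult hermite_sum_LIMSEQ)
  have meas: "(\<lambda>x. chi q s x * chi q t x) \<in> borel_measurable \<mu>" "\<And>N. ?S N \<in> borel_measurable \<mu>"
    by measurable
  note dom = meas w lim AE_I2[OF bound]
  show "integrable \<mu> (\<lambda>x. chi q s x * chi q t x)"
    by (rule integrable_dominated_convergence[OF dom])
  have "(\<lambda>N. \<integral>x. ?S N x \<partial>\<mu>) \<longlonglongrightarrow> (\<integral>x. chi q s x * chi q t x \<partial>\<mu>)"
    by (rule integral_dominated_convergence[OF dom])
  moreover have "(\<integral>x. ?S N x \<partial>\<mu>) = (\<Sum>n<N. of_real (euler_coeff q n) * (s * t / of_real q) ^ n)" for N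
  proof -
    have "?S N = (\<lambda>x. \<Sum>m<N. \<Sum>n<N. of_real (hermite_term q m x * hermite_term q n x) * (s ^ m * t ^ n))"
      by (simp add: fun_eq_iff hermite_sum_def sum_product mult_ac)
    then have "(\<integral>x. ?S N x \<partial>\<mu>) = (\<integral>x. (\<Sum>m<N. \<Sum>n<N. of_real (hermite_term q m x * hermite_term q n x) * (s ^ m * t ^ n)) \<partial>\<mu>)"
      by simp
    also have "\<dots> = (\<Sum>m<N. \<Sum>n<N. \<integral>x. of_real (hermite_term q m x * hermite_term q n x) * (s ^ m * t ^ n) \<partial>\<mu>)"
      using integrable_of_real[OF hermite_term_orthogonal(1), where 'a = complex]
      by (subst Bochner_Integration.integral_sum)
        (auto intro!: Bochner_Integration.integrable_sum integrable_mult_left sum.cong Bochner_Integration.integral_sum simp del: of_real_mult)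
    also have "\<dots> = (\<Sum>m<N. \<Sum>n<N. if m = n then of_real (euler_coeff q n / q ^ n) * (s ^ m * t ^ n) else 0)"
      using integrable_of_real[OF hermite_term_orthogonal(1), where 'a = complex]
      by (intro sum.cong refl)
        (simp add: integral_mult_left integral_of_real hermite_term_orthogonal(2) del: of_real_mult)
    also have "\<dots> = (\<Sum>n<N. of_real (euler_coeff q n) * (s * t / of_real q) ^ n)"
      by (simp add: power_divide power_mult_distrib)
    finally show ?thesis .
  qed
  moreover have "(\<lambda>N. \<Sum>n<N. of_real (euler_coeff q n) * (s * t / of_real q) ^ n)
      \<longlonglongrightarrow> qpoch_inf (- (s * t / of_real q)) (of_real q)"
    using summable_LIMSEQ[OF euler_summable[OF q]] unfolding euler_identity[OF q] .
  ultimately show "(\<integral>x. chi q s x * chi q t x \<partial>\<mu>) = qpoch_inf (- (s * t) / of_real q) (of_real q)"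
    using LIMSEQ_unique by simp
qed

text \<open>Write L_s for integration against \<chi>_s \<chi>_t. Shift and contiguous relation give
  L_(s/q) u_n(x; s/q, t) = \<kappa> L_s u_{n+1}(x; s, t) + (1 + s t / q^(n+2)) L_s u_n(x; s, t). The
  step therefore uses the hypothesis at s and at s/q, and s \<noteq> 0 allows division by \<kappa>.
  \<open>has_bochner_integral\<close> delivers integrability together with the value.\<close>

lemma alsalam_chihara_chi_chi_nonzero:
  assumes "s \<noteq> 0"
  shows "has_bochner_integral \<mu> (\<lambda>x. poly (alsalam_chihara q s t n) (of_real x) * (chi q s x * chi q t x))
    (if n = 0 then qpoch_inf (- (s * t) / of_real q) (of_real q) else 0)"
  using assms
proof (induction n arbitrary: s)
  case 0
  show ?case
    using integrable_chi_chi[of s t] integral_chi_chi[of s t] by (simp add: has_bochner_integral_iff)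
next
  case (Suc n)
  define Q where "Q = complex_of_real q"
  have Q: "Q \<noteq> 0" using q by (simp add: Q_def)
  define \<kappa> where "\<kappa> = s * (1 / Q ^ (n + 1) - 1)"
  have "Q ^ (n + 1) \<noteq> 1" using one_minus_power_nonzero[OF q, of n] by (simp add: Q_def)
  then have \<kappa>: "\<kappa> \<noteq> 0" using Suc.prems Q by (simp add: \<kappa>_def)
  let ?u = "\<lambda>s n x. poly (alsalam_chihara q s t n) (complex_of_real x) * (chi q s x * chi q t x)"
  let ?I = "\<lambda>s. if n = 0 then qpoch_inf (- (s * t) / Q) Q else 0"
  have IH: "has_bochner_integral \<mu> (?u s n) (?I s)" if "s \<noteq> 0" for s
    using Suc.IH[OF that] unfolding Q_def .
  have eq: "?u s (Suc n) = (\<lambda>x. (?u (s / Q) n x - (1 + s * t / Q ^ (n + 2)) * ?u s n x) / \<kappa>)"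
  proof
    fix x
    have "chi q (s / Q) x = (1 + 2 * of_real x * (s / Q) - (s / Q)\<^sup>2) * chi q s x"
      using chi_shift[OF q, of "s / Q" x] Q by (simp add: Q_def)
    then have "?u (s / Q) n x
        = ((1 + 2 * of_real x * (s / Q) - (s / Q)\<^sup>2) * poly (alsalam_chihara q (s / Q) t n) (of_real x)) * (chi q s x * chi q t x)"
      by simp
    also have "\<dots> = \<kappa> * ?u s (Suc n) x + (1 + s * t / Q ^ (n + 2)) * ?u s n x"
      unfolding Q_def alsalam_chihara_contiguous[OF q] \<kappa>_def by (simp only: Suc_eq_plus1 ring_distribs mult_ac)
    finally show "?u s (Suc n) x = (?u (s / Q) n x - (1 + s * t / Q ^ (n + 2)) * ?u s n x) / \<kappa>"
      using \<kappa> by (simp del: alsalam_chihara.simps)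
  qed
  have "has_bochner_integral \<mu> (?u s (Suc n)) ((?I (s / Q) - (1 + s * t / Q ^ (n + 2)) * ?I s) / \<kappa>)"
    unfolding eq using Suc.prems Q
    by (intro has_bochner_integral_divide_zero has_bochner_integral_diff has_bochner_integral_mult_right IH) auto
  \<comment> \<open>For n = 0 this is (-s t / q^2; q)_\<infinity> = (1 + s t / q^2) (-s t / q;
    q)_\<infinity>; for n > 0 both values are already 0.\<close>
  moreover have "?I (s / Q) - (1 + s * t / Q ^ (n + 2)) * ?I s = 0"
    using qpoch_inf_functional_equation[OF q, of "s * t / Q\<^sup>2"] Q
    by (simp add: Q_def power2_eq_square mult_ac)
  ultimately show ?case by simp
qed

lemma alsalam_chihara_chi_chi:
  "has_bochner_integral \<mu> (\<lambda>x. poly (alsalam_chihara q s t n) (of_real x) * (chi q s x * chi q t x))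
    (if n = 0 then qpoch_inf (- (s * t) / of_real q) (of_real q) else 0)"
proof -
  consider "s \<noteq> 0" | "t \<noteq> 0" | "s = 0" "t = 0" by blast
  then show ?thesis
  proof cases
    case 1
    then show ?thesis by (rule alsalam_chihara_chi_chi_nonzero)
  next
    case 2
    then show ?thesis using alsalam_chihara_chi_chi_nonzero[OF 2, of s n]
      by (simp only: alsalam_chihara_commute[of q t s] mult.commute[of t s] mult.commute[of "chi q t _"])
  next
    case 3
    \<comment> \<open>As \<chi>_0 = 1, the integrand is the rescaled h_n, and its integral is the
      pairing with h_0 = 1.\<close>
    have "has_bochner_integral \<mu> (hermite_term q n) (if n = 0 then 1 else 0)"
      using hermite_term_orthogonal[of n 0] hermite_term_simps(1)[OF q]
      by (simp add: has_bochner_integral_iff)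
    from has_bochner_integral_of_real[OF this, where 'a = complex]
    show ?thesis using 3 by (simp add: alsalam_chihara_0_0[OF q] qpoch_inf_def if_distrib cong: if_cong)
  qed
qed

text \<open>The recurrence writes x^(k+1) u_n through x^k times u_{n+1}, u_n and u_{n-1}, so
  integrability of all u_n \<chi>_s \<chi>_t spreads to x^k u_n by induction on k. The case u_0 = 1
  covers the monomials.\<close>

lemma integrable_poly_chi_chi:
  fixes p :: "complex poly"
  shows "integrable \<mu> (\<lambda>x. poly p (of_real x) * (chi q s x * chi q t x))"
proof -
  let ?w = "\<lambda>x. chi q s x * chi q t x"
  have "integrable \<mu> (\<lambda>x. of_real x ^ k * (poly (alsalam_chihara q s t n) (of_real x) * ?w x))" for k n
  proof (induction k arbitrary: n)
    case 0
    show ?case using alsalam_chihara_chi_chi[of s t n] by (simp add: has_bochner_integral_iff)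
  next
    case (Suc k)
    let ?u = "\<lambda>n x. of_real x ^ k * (poly (alsalam_chihara q s t n) (of_real x) * ?w x)"
    have "of_real x ^ Suc k * (poly (alsalam_chihara q s t n) (of_real x) * ?w x)
        = ((1 - of_real q ^ (n + 1)) * ?u (n + 1) x + (s + t) / of_real q * ?u n x
          + (if n = 0 then 0 else s * t / (of_real q)\<^sup>2 + of_real q ^ (n - 1)) * ?u (n - 1) x) / (2 * of_real q ^ n)" for x
    proof -
      have "2 * of_real q ^ n * (of_real x * poly (alsalam_chihara q s t n) (of_real x))
        = (1 - of_real q ^ (n + 1)) * poly (alsalam_chihara q s t (n + 1)) (of_real x)
          + (s + t) / of_real q * poly (alsalam_chihara q s t n) (of_real x)
          + (if n = 0 then 0 else s * t / (of_real q)\<^sup>2 + of_real q ^ (n - 1)) * poly (alsalam_chihara q s t (n - 1)) (of_real x)"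
        using arg_cong[OF alsalam_chihara_poly_rec[OF q, of n s t], of "\<lambda>p. poly p (of_real x)"]
        by (simp add: mult_ac split: if_splits del: alsalam_chihara.simps)
      from arg_cong[OF this, of "\<lambda>y. y * (of_real x ^ k * ?w x)"]
      have "2 * of_real q ^ n * (of_real x ^ Suc k * (poly (alsalam_chihara q s t n) (of_real x) * ?w x))
        = (1 - of_real q ^ (n + 1)) * ?u (n + 1) x + (s + t) / of_real q * ?u n x
          + (if n = 0 then 0 else s * t / (of_real q)\<^sup>2 + of_real q ^ (n - 1)) * ?u (n - 1) x"
        unfolding distrib_right by (simp only: power_Suc mult_ac)
      then show ?thesis using q by (simp add: nonzero_eq_divide_eq mult.commute del: alsalam_chihara.simps)
    qed
    then show ?case
      by (simp only:) (intro integrable_divide_zero Bochner_Integration.integrable_add integrable_mult_right Suc.IH)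
  qed
  from this[of _ 0] have "integrable \<mu> (\<lambda>x. of_real x ^ k * ?w x)" for k by simp
  then have "integrable \<mu> (\<lambda>x. \<Sum>i\<le>degree p. coeff p i * (of_real x ^ i * ?w x))"
    by (intro Bochner_Integration.integrable_sum integrable_mult_right)
  then show ?thesis by (simp add: poly_altdef sum_distrib_right mult.assoc)
qed

lemma alsalam_chihara_orthogonal:
  assumes st: "\<And>n::nat. n \<ge> 1 \<Longrightarrow> s * t \<noteq> - of_real (q ^ (n + 1))"
    and c: "qpoch_inf (- (s * t) / of_real q) (of_real q) \<noteq> 0"
  shows "m \<noteq> n \<Longrightarrow> (\<integral>x. poly (alsalam_chihara q s t m) (of_real x) * poly (alsalam_chihara q s t n) (of_real x)
      * (chi q s x * chi q t x) \<partial>\<mu>) = 0"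
    and "(\<integral>x. (poly (alsalam_chihara q s t n) (of_real x))\<^sup>2 * (chi q s x * chi q t x) \<partial>\<mu>) \<noteq> 0"
proof -
  define L where "L p = (\<integral>x. poly p (of_real x) * (chi q s x * chi q t x) \<partial>\<mu>)" for p :: "complex poly"
  have add: "L (p + r) = L p + L r" for p r
    unfolding L_def poly_add distrib_right
    by (intro Bochner_Integration.integral_add integrable_poly_chi_chi)
  have smult: "L (smult a p) = a * L p" for a p
    unfolding L_def by (simp add: mult.assoc)
  have vanish: "L (alsalam_chihara q s t n) = 0" if "n \<ge> 1" for n
    using alsalam_chihara_chi_chi[of s t n] that by (simp add: has_bochner_integral_iff L_def)
  have "L 1 \<noteq> 0" using c integral_chi_chi[of s t] by (simp add: L_def)
  note orth = alsalam_chihara_functional_orthogonal[of q L, OF q add smult vanish this st]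
  show "m \<noteq> n \<Longrightarrow> (\<integral>x. poly (alsalam_chihara q s t m) (of_real x) * poly (alsalam_chihara q s t n) (of_real x)
      * (chi q s x * chi q t x) \<partial>\<mu>) = 0"
    using orth(1)[of m n] by (simp add: L_def)
  show "(\<integral>x. (poly (alsalam_chihara q s t n) (of_real x))\<^sup>2 * (chi q s x * chi q t x) \<partial>\<mu>) \<noteq> 0"
    using orth(2)[of n] by (simp add: L_def)
qed

end

section \<open>Complex measures given by a density\<close>

text \<open>Among the measurable subsets of A, the integral of r is largest on A \<inter> {r > 0},
  the positive part of a Hahn decomposition. So the supremum is attained and equals the integral of
  the positive part of r, which is what \<open>ennreal (r x)\<close> is.\<close>

lemma pos_variation_density:
  fixes \<mu> :: "'a measure" and r :: "'a \<Rightarrow> real"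
  assumes [simp, measurable_cong]: "sets M = sets \<mu>" and r: "integrable \<mu> r"
    and \<phi>: "\<And>B. B \<in> sets M \<Longrightarrow> \<phi> B = (LINT x:B|\<mu>. r x)"
  shows "pos_variation M \<phi> = density \<mu> (\<lambda>x. ennreal (r x))"
proof -
  have [measurable]: "r \<in> borel_measurable \<mu>" using r by simp
  have SUP: "(SUP B\<in>{B \<in> sets M. B \<subseteq> A}. ennreal (\<phi> B)) = emeasure (density \<mu> (\<lambda>x. ennreal (r x))) A"
    if A: "A \<in> sets \<mu>" for A
  proof (rule antisym)
    show "(SUP B\<in>{B \<in> sets M. B \<subseteq> A}. ennreal (\<phi> B)) \<le> emeasure (density \<mu> (\<lambda>x. ennreal (r x))) A"
    proof (rule SUP_least)
      fix B assume B: "B \<in> {B \<in> sets M. B \<subseteq> A}"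
      then have [measurable]: "B \<in> sets \<mu>" by simp
      have int: "integrable \<mu> (\<lambda>x. indicator B x * r x)"
        using integrable_mult_indicator[OF \<open>B \<in> sets \<mu>\<close> r] by simp
      have "\<phi> B = (\<integral>x. indicator B x * r x \<partial>\<mu>)"
        using B \<phi>[of B] by (simp add: set_lebesgue_integral_def)
      also have "\<dots> \<le> (\<integral>x. indicator B x * max 0 (r x) \<partial>\<mu>)"
        using integrable_mult_indicator[OF \<open>B \<in> sets \<mu>\<close> integrable_max[OF integrable_zero r]] int
        by (intro integral_mono) (auto simp: indicator_def)
      finally have "ennreal (\<phi> B) \<le> ennreal (\<integral>x. indicator B x * max 0 (r x) \<partial>\<mu>)"
        by (rule ennreal_leI)
      also have "\<dots> = (\<integral>\<^sup>+x. ennreal (indicator B x * max 0 (r x)) \<partial>\<mu>)"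
        using integrable_mult_indicator[OF \<open>B \<in> sets \<mu>\<close> integrable_max[OF integrable_zero r]]
        by (intro nn_integral_eq_integral[symmetric]) auto
      also have "\<dots> \<le> (\<integral>\<^sup>+x. ennreal (r x) * indicator A x \<partial>\<mu>)"
        using B by (intro nn_integral_mono) (auto simp: indicator_def max_def ennreal_neg)
      also have "\<dots> = emeasure (density \<mu> (\<lambda>x. ennreal (r x))) A"
        using A by (simp add: emeasure_density)
      finally show "ennreal (\<phi> B) \<le> emeasure (density \<mu> (\<lambda>x. ennreal (r x))) A" .
    qed
  next
    define B where "B = A \<inter> {x \<in> space \<mu>. r x > 0}"
    have B: "B \<in> sets \<mu>" "B \<subseteq> A" using A by (auto simp: B_def)
    have int: "integrable \<mu> (\<lambda>x. indicator B x * r x)"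
      using integrable_mult_indicator[OF B(1) r] by simp
    have "emeasure (density \<mu> (\<lambda>x. ennreal (r x))) A = (\<integral>\<^sup>+x. ennreal (r x) * indicator A x \<partial>\<mu>)"
      using A by (simp add: emeasure_density)
    also have "\<dots> = (\<integral>\<^sup>+x. ennreal (indicator B x * r x) \<partial>\<mu>)"
      by (intro nn_integral_cong) (auto simp: B_def indicator_def ennreal_neg)
    also have "\<dots> = ennreal (\<integral>x. indicator B x * r x \<partial>\<mu>)"
      using int by (intro nn_integral_eq_integral) (auto simp: B_def indicator_def)
    also have "\<dots> = ennreal (\<phi> B)"
      using B \<phi>[of B] by (simp add: set_lebesgue_integral_def)
    also have "\<dots> \<le> (SUP B\<in>{B \<in> sets M. B \<subseteq> A}. ennreal (\<phi> B))"
      using B by (intro SUP_upper) simp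
    finally show "emeasure (density \<mu> (\<lambda>x. ennreal (r x))) A \<le> (SUP B\<in>{B \<in> sets M. B \<subseteq> A}. ennreal (\<phi> B))" .
  qed
  have sp: "space M = space \<mu>" by (rule sets_eq_imp_space_eq) simp
  let ?D = "density \<mu> (\<lambda>x. ennreal (r x))"
  \<comment> \<open>\<open>measure_of\<close> sees a set function only on the sigma-algebra, where
    the supremum agrees with the measure of the density.\<close>
  have "pos_variation M \<phi> = measure_of (space ?D) (sets ?D) (emeasure ?D)"
    unfolding pos_variation_def sp space_density sets_density assms(1)
    using SUP by (intro measure_of_eq sets.space_closed) (simp add: sets.sigma_sets_eq)
  then show ?thesis by (simp only: measure_of_of_measure)
qed

text \<open>The four variations have as densities the positive parts of \<plusminus>Re g and
  \<plusminus>Im g. Each is at most |g|, so integrability of g f passes to every part, and the parts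
  recombine to g f.\<close>

lemma cm_integral_density:
  fixes \<mu> :: "'a measure" and g f :: "'a \<Rightarrow> complex"
  assumes sets: "sets M = sets \<mu>" and g: "integrable \<mu> g"
    and \<nu>: "\<And>B. B \<in> sets M \<Longrightarrow> \<nu> B = (LINT x:B|\<mu>. g x)"
    and f: "f \<in> borel_measurable \<mu>" and gf: "integrable \<mu> (\<lambda>x. g x * f x)"
  shows "cm_integrable M \<nu> f" and "cm_integral M \<nu> f = (\<integral>x. g x * f x \<partial>\<mu>)"
proof -
  have [measurable]: "f \<in> borel_measurable \<mu>" "g \<in> borel_measurable \<mu>" using f g by simp_all
  have int: "integrable \<mu> (\<lambda>x. indicator B x *\<^sub>R g x)" if "B \<in> sets M" for B
    using integrable_mult_indicator[OF _ g, of B] that sets by simp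
  have re: "Re (\<nu> B) = (LINT x:B|\<mu>. Re (g x))" and im: "Im (\<nu> B) = (LINT x:B|\<mu>. Im (g x))"
    if "B \<in> sets M" for B
    using integral_Re[OF int[OF that]] integral_Im[OF int[OF that]] \<nu>[OF that]
    by (simp_all add: set_lebesgue_integral_def)
  have neg: "(LINT x:B|\<mu>. - h x) = - (LINT x:B|\<mu>. h x)" for B and h :: "'a \<Rightarrow> real"
    by (simp add: set_lebesgue_integral_def)
  have pv: "pos_variation M (\<lambda>A. Re (\<nu> A)) = density \<mu> (\<lambda>x. ennreal (Re (g x)))"
      "pos_variation M (\<lambda>A. - Re (\<nu> A)) = density \<mu> (\<lambda>x. ennreal (- Re (g x)))"
      "pos_variation M (\<lambda>A. Im (\<nu> A)) = density \<mu> (\<lambda>x. ennreal (Im (g x)))"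
      "pos_variation M (\<lambda>A. - Im (\<nu> A)) = density \<mu> (\<lambda>x. ennreal (- Im (g x)))"
    using g by (auto intro!: pos_variation_density sets simp: re im neg)
  \<comment> \<open>Bochner integration against a density asks for a nonnegative real function;
    \<open>ennreal\<close> truncates at 0, so passing to \<open>max 0 (h x)\<close> does not change
    the measure.\<close>
  have dens: "density \<mu> (\<lambda>x. ennreal (h x)) = density \<mu> (\<lambda>x. ennreal (max 0 (h x)))" for h :: "'a \<Rightarrow> real"
    by (simp add: max_def ennreal_neg if_distrib cong: if_cong) (metis ennreal_neg linorder_le_cases)
  have part: "integrable (density \<mu> (\<lambda>x. ennreal (h x))) f"
      "integral\<^sup>L (density \<mu> (\<lambda>x. ennreal (h x))) f = (\<integral>x. max 0 (h x) *\<^sub>R f x \<partial>\<mu>)"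
      "integrable \<mu> (\<lambda>x. max 0 (h x) *\<^sub>R f x)"
    if [measurable]: "h \<in> borel_measurable \<mu>" and h: "\<And>x. \<bar>h x\<bar> \<le> norm (g x)" for h :: "'a \<Rightarrow> real"
  proof -
    show int: "integrable \<mu> (\<lambda>x. max 0 (h x) *\<^sub>R f x)"
    proof (rule Bochner_Integration.integrable_bound[OF gf])
      have "norm (max 0 (h x) *\<^sub>R f x) \<le> norm (g x * f x)" for x
        using h[of x] by (auto simp: norm_mult max_def intro!: mult_right_mono)
      then show "AE x in \<mu>. norm (max 0 (h x) *\<^sub>R f x) \<le> norm (g x * f x)" by simp
    qed measurable
    show "integrable (density \<mu> (\<lambda>x. ennreal (h x))) f"
      unfolding dens[of h] using int by (subst integrable_density) auto
    show "integral\<^sup>L (density \<mu> (\<lambda>x. ennreal (h x))) f = (\<integral>x. max 0 (h x) *\<^sub>R f x \<partial>\<mu>)"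
      unfolding dens[of h] by (subst integral_density) auto
  qed
  have b: "\<bar>Re (g x)\<bar> \<le> norm (g x)" "\<bar>- Re (g x)\<bar> \<le> norm (g x)" "\<bar>Im (g x)\<bar> \<le> norm (g x)" "\<bar>- Im (g x)\<bar> \<le> norm (g x)" for x
    by (simp_all add: abs_Re_le_cmod abs_Im_le_cmod)
  have m: "(\<lambda>x. Re (g x)) \<in> borel_measurable \<mu>" "(\<lambda>x. - Re (g x)) \<in> borel_measurable \<mu>"
      "(\<lambda>x. Im (g x)) \<in> borel_measurable \<mu>" "(\<lambda>x. - Im (g x)) \<in> borel_measurable \<mu>"
    by measurable
  note p = part[OF m(1) b(1)] part[OF m(2) b(2)] part[OF m(3) b(3)] part[OF m(4) b(4)]
  show "cm_integrable M \<nu> f" unfolding cm_integrable_def pv using p by simp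
  have comb: "(\<integral>x. max 0 (h x) *\<^sub>R f x \<partial>\<mu>) - (\<integral>x. max 0 (- h x) *\<^sub>R f x \<partial>\<mu>) = (\<integral>x. h x *\<^sub>R f x \<partial>\<mu>)"
      and comb_int: "integrable \<mu> (\<lambda>x. h x *\<^sub>R f x)"
    if "integrable \<mu> (\<lambda>x. max 0 (h x) *\<^sub>R f x)" "integrable \<mu> (\<lambda>x. max 0 (- h x) *\<^sub>R f x)" for h :: "'a \<Rightarrow> real"
  proof -
    have eq: "(\<lambda>x. h x *\<^sub>R f x) = (\<lambda>x. max 0 (h x) *\<^sub>R f x - max 0 (- h x) *\<^sub>R f x)"
      by (auto simp: max_def fun_eq_iff)
    show "(\<integral>x. max 0 (h x) *\<^sub>R f x \<partial>\<mu>) - (\<integral>x. max 0 (- h x) *\<^sub>R f x \<partial>\<mu>) = (\<integral>x. h x *\<^sub>R f x \<partial>\<mu>)"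
      unfolding eq using that by (rule Bochner_Integration.integral_diff[symmetric])
    show "integrable \<mu> (\<lambda>x. h x *\<^sub>R f x)"
      unfolding eq using that by (rule Bochner_Integration.integrable_diff)
  qed
  have "cm_integral M \<nu> f = (\<integral>x. Re (g x) *\<^sub>R f x \<partial>\<mu>) + \<i> * (\<integral>x. Im (g x) *\<^sub>R f x \<partial>\<mu>)"
    unfolding cm_integral_def pv using p comb[of "\<lambda>x. Re (g x)"] comb[of "\<lambda>x. Im (g x)"] by simp
  also have "\<dots> = (\<integral>x. Re (g x) *\<^sub>R f x + \<i> * (Im (g x) *\<^sub>R f x) \<partial>\<mu>)"
    unfolding integral_mult_right_zero[symmetric]
    by (intro Bochner_Integration.integral_add[symmetric] integrable_mult_right
      comb_int[OF p(3) p(6)] comb_int[OF p(9) p(12)])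
  also have "\<dots> = (\<integral>x. g x * f x \<partial>\<mu>)"
  proof (intro Bochner_Integration.integral_cong refl)
    fix x
    have "Re (g x) *\<^sub>R f x + \<i> * (Im (g x) *\<^sub>R f x) = (of_real (Re (g x)) + \<i> * of_real (Im (g x))) * f x"
      by (simp only: scaleR_conv_of_real distrib_right mult.assoc)
    then show "Re (g x) *\<^sub>R f x + \<i> * (Im (g x) *\<^sub>R f x) = g x * f x"
      by (simp only: complex_eq[symmetric])
  qed
  finally show "cm_integral M \<nu> f = (\<integral>x. g x * f x \<partial>\<mu>)" .
qed

text \<open>Countable additivity is dominated convergence for the indicators of the finite unions,
  with |g| as majorant.\<close>

lemma complex_measure_density:
  fixes g :: "'a \<Rightarrow> complex"
  assumes sets: "sets M = sets \<mu>" and g: "integrable \<mu> g"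
  shows "complex_measure M (\<lambda>A. LINT x:A|\<mu>. g x)"
  unfolding complex_measure_def
proof (intro conjI allI impI)
  show "(LINT x:{}|\<mu>. g x) = 0" by (simp add: set_lebesgue_integral_def)
next
  fix A :: "nat \<Rightarrow> 'a set"
  assume A: "range A \<subseteq> sets M" "disjoint_family A"
  then have A_sets: "A i \<in> sets \<mu>" for i using sets by auto
  have int: "integrable \<mu> (\<lambda>x. indicator B x *\<^sub>R g x)" if "B \<in> sets \<mu>" for B
    using integrable_mult_indicator[OF that g] .
  have part: "(\<Sum>i<n. LINT x:A i|\<mu>. g x) = (\<integral>x. indicator (\<Union>i<n. A i) x *\<^sub>R g x \<partial>\<mu>)" for n
  proof -
    have "disjoint_family_on A {..<n}" using A(2) by (auto simp: disjoint_family_on_def)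
    then have "indicator (\<Union>i<n. A i) x *\<^sub>R g x = (\<Sum>i<n. indicator (A i) x *\<^sub>R g x)" for x
      by (simp add: indicator_UN_disjoint scaleR_sum_left)
    then show ?thesis
      unfolding set_lebesgue_integral_def
      by (simp only:) (intro Bochner_Integration.integral_sum[symmetric] int A_sets)
  qed
  have "(\<lambda>n. \<integral>x. indicator (\<Union>i<n. A i) x *\<^sub>R g x \<partial>\<mu>) \<longlonglongrightarrow> (\<integral>x. indicator (\<Union>i. A i) x *\<^sub>R g x \<partial>\<mu>)"
  proof (rule integral_dominated_convergence[where w = "\<lambda>x. norm (g x)"])
    show "AE x in \<mu>. (\<lambda>n. indicator (\<Union>i<n. A i) x *\<^sub>R g x) \<longlonglongrightarrow> indicator (\<Union>i. A i) x *\<^sub>R g x"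
      by (intro AE_I2 tendsto_intros LIMSEQ_indicator_UN)
  qed (use int A_sets g in \<open>auto intro!: borel_measurable_integrable[OF int] simp: indicator_def\<close>)
  then show "(\<lambda>i. LINT x:A i|\<mu>. g x) sums (LINT x:(\<Union>i. A i)|\<mu>. g x)"
    unfolding sums_def part by (simp add: set_lebesgue_integral_def)
qed

theorem theorem5p2:
  fixes q :: real and \<mu> :: "real measure" and t1 t2 :: complex
  assumes "0 < q" and "q < 1"
    and "\<mu> \<in> qinv_hermite_measures q"
    and "\<And>n::nat. n \<ge> 1 \<Longrightarrow> t1 * t2 \<noteq> - of_real (q ^ (n + 1))"
    and "\<And>k::nat. t1 * t2 \<noteq> - of_real (q powi (1 - int k))"
  shows "complex_measure borel (nu_measure q \<mu> t1 t2)
    \<and> orthogonal_polys (nu_measure q \<mu> t1 t2) (alsalam_chihara q t1 t2)"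
proof -
  interpret qinv_hermite_measure q \<mu> using assms(1-3) by unfold_locales
  define c where "c = qpoch_inf (- (t1 * t2) / of_real q) (of_real q)"
  \<comment> \<open>A vanishing factor 1 + t1 t2 q^(k-1) would mean t1 t2 = -q^(1-k). The exponent
    is negative for k \<ge> 2, hence \<open>powi\<close>.\<close>
  have c: "c \<noteq> 0"
    unfolding c_def
  proof (rule qpoch_inf_nonzero[OF q])
    fix k
    show "- (t1 * t2) / of_real q * of_real q ^ k \<noteq> 1"
    proof
      assume *: "- (t1 * t2) / of_real q * of_real q ^ k = 1"
      have "complex_of_real (q powi (1 - int k)) = of_real q / of_real q ^ k"
        using q by (simp add: power_int_diff)
      also have "\<dots> = - (t1 * t2)" using * q by (simp add: field_simps)
      finally show False using assms(5)[of k] by simp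
    qed
  qed
  define g where "g x = chi q t1 x * chi q t2 x / c" for x
  have \<nu>: "nu_measure q \<mu> t1 t2 = (\<lambda>A. LINT x:A|\<mu>. g x)"
    by (simp add: nu_measure_def g_def c_def fun_eq_iff)
  have g: "integrable \<mu> g"
    unfolding g_def by (intro integrable_divide_zero integrable_chi_chi)
  let ?u = "\<lambda>n x. poly (alsalam_chihara q t1 t2 n) (complex_of_real x)"
  have gp: "g x * poly p (of_real x) = poly p (of_real x) * (chi q t1 x * chi q t2 x) / c" for p x
    by (simp add: g_def)
  \<comment> \<open>Formulated for an arbitrary polynomial p, so that p = u_m u_n and p = u_n^2 are
    both instances.\<close>
  have int_eq: "cm_integrable borel (nu_measure q \<mu> t1 t2) (\<lambda>x. poly p (of_real x))"
    "cm_integral borel (nu_measure q \<mu> t1 t2) (\<lambda>x. poly p (of_real x))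
      = (\<integral>x. poly p (of_real x) * (chi q t1 x * chi q t2 x) \<partial>\<mu>) / c" for p
  proof -
    have "(\<lambda>x. poly p (complex_of_real x)) \<in> borel_measurable \<mu>"
      by (simp add: borel_measurable_continuous_onI continuous_intros cong: measurable_cong_sets)
    moreover have "integrable \<mu> (\<lambda>x. g x * poly p (of_real x))"
      unfolding gp by (intro integrable_divide_zero integrable_poly_chi_chi)
    ultimately have "cm_integrable borel (nu_measure q \<mu> t1 t2) (\<lambda>x. poly p (of_real x))"
      "cm_integral borel (nu_measure q \<mu> t1 t2) (\<lambda>x. poly p (of_real x)) = (\<integral>x. g x * poly p (of_real x) \<partial>\<mu>)"
      by (rule cm_integral_density[OF sets_eq[symmetric] g, rotated]; simp add: \<nu>)+
    then show "cm_integrable borel (nu_measure q \<mu> t1 t2) (\<lambda>x. poly p (of_real x))"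
      "cm_integral borel (nu_measure q \<mu> t1 t2) (\<lambda>x. poly p (of_real x))
      = (\<integral>x. poly p (of_real x) * (chi q t1 x * chi q t2 x) \<partial>\<mu>) / c"
      unfolding gp by simp_all
  qed
  note orth = alsalam_chihara_orthogonal[OF assms(4) c[unfolded c_def]]
  have "cm_integrable borel (nu_measure q \<mu> t1 t2) (\<lambda>x. ?u m x * ?u n x)" for m n
    using int_eq(1)[of "alsalam_chihara q t1 t2 m * alsalam_chihara q t1 t2 n"] by simp
  moreover have "cm_integral borel (nu_measure q \<mu> t1 t2) (\<lambda>x. ?u m x * ?u n x) = 0" if "m \<noteq> n" for m n
    using int_eq(2)[of "alsalam_chihara q t1 t2 m * alsalam_chihara q t1 t2 n"] orth(1)[OF _ that] by simp
  moreover have "cm_integral borel (nu_measure q \<mu> t1 t2) (\<lambda>x. (?u n x)\<^sup>2) \<noteq> 0" for n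
    using int_eq(2)[of "(alsalam_chihara q t1 t2 n)\<^sup>2"] orth(2)[of n] c by simp
  moreover have "complex_measure borel (nu_measure q \<mu> t1 t2)"
    unfolding \<nu> by (intro complex_measure_density g) simp
  ultimately show ?thesis
    by (simp add: orthogonal_polys_def degree_alsalam_chihara[OF q])
qed

end
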